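(* Let $\Bbbk$ be a field, let $t$ be the standard rational coordinate on $\mathbb{P}^1_{\Bbbk}$ (with simple pole at $\infty$), let $\alpha\ge 0$ be a rational number, and let $D=\alpha\cdot(\infty)$. Let $$0=\frac{c_0}{d_0}<\frac{c_1}{d_1}<\cdots<\frac{c_r}{d_r}=\alpha$$ be all the nonnegative best lower approximations to $\alpha$ (written with $d_i>0$). Then the canonical ring $S=S_D$ has a minimal presentation consisting of the $r+1$ generators $f_i=t^{c_i}u^{d_i}$ ($0\le i\le r$) and $\binom r2$ relations, one for each pair $(i,j)$ with $0\le i$, $j\le r$, $j\ge i+2$, each of one of the two forms $$g_{ij}=f_if_j-f_{h_{ij}}^{a_{ij}}\quad (i<h_{ij}<j)\qquad\text{or}\qquad g_{ij}=f_if_j-f_{h_{ij}}^{a_{ij}}f_{h_{ij}+1}^{b_{ij}}\quad(i<h_{ij}<h_{ij}+1<j),$$ where $h_{ij}$ is an integer and $a_{ij},b_{ij}$ are positive integers.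
   Context: For a $\mathbb{Q}$-divisor $D=\sum_i\alpha_iP_i$ on $\mathbb{P}^1_{\Bbbk}$, put $\lfloor dD\rfloor=\sum_i\lfloor d\alpha_i\rfloor P_i$. The canonical ring of $D$ is the graded $\Bbbk$-algebra $S_D=\bigoplus_{d\ge0}u^dH^0(\mathbb{P}^1,O(\lfloor dD\rfloor))\subseteq \Bbbk(t)[u]$, where $H^0(\mathbb{P}^1,O(E))$ is the space of rational functions $f$ with $f=0$ or $\operatorname{div}(f)+E\ge0$, and $u$ is a dummy variable recording the degree. A best lower approximation to a real number $\alpha$ is a fraction $c/d\le\alpha$ ($c,d\in\mathbb{Z}$, $d>0$) such that there is no fraction $c'/d'$ ($d'>0$) with $c/d\le c'/d'\le\alpha$ but $d'<d$. "Minimal presentation" means: the $f_i$ form a minimal set of generators of the $\Bbbk$-algebra $S$, and the kernel of the surjection $\Bbbk[x_0,\dots,x_r]\to S$, $x_i\mapsto f_i$, is minimally generated as an ideal by the polynomials obtained from the $g_{ij}$ by replacing each $f_i$ by $x_i$. *)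

theory Defs
  imports
    "HOL-Computational_Algebra.Computational_Algebra"
    "HOL-Library.Poly_Mapping"
begin

section \<open>Rational functions and divisors on the projective line\<close>

text \<open>
  The closed points of the affine line over an arbitrary field correspond to the monic irreducible
  polynomials; the projective line has one further closed point.
\<close>

typedef (overloaded) 'k monic_irred = "{p :: 'k::field poly. irreducible p \<and> lead_coeff p = 1}"
  morphisms poly_of_monic_irred Abs_monic_irred
proof
  have "irreducible [:0, 1 :: 'k:]"
  proof (rule irreducibleI)
    fix a b :: "'k poly"
    assume ab: "[:0, 1:] = a * b"
    then have "a \<noteq> 0" "b \<noteq> 0" by auto
    then have "degree a + degree b = 1"
      using degree_mult_eq[of a b] by (simp flip: ab)
    then have "degree a = 0 \<or> degree b = 0" by linarith
    then show "is_unit a \<or> is_unit b"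
      using \<open>a \<noteq> 0\<close> \<open>b \<noteq> 0\<close> by (simp add: is_unit_iff_degree)
  qed (simp_all add: is_unit_iff_degree)
  then show "[:0, 1:] \<in> {p :: 'k poly. irreducible p \<and> lead_coeff p = 1}" by simp
qed

context notes [[typedef_overloaded]] begin

datatype ('k :: field) p1_point = Infinity | Affine "'k monic_irred"

end

type_synonym 'k ratfun = "'k poly fract"

text \<open>
  The constant \<open>multiplicity\<close> is not available for polynomials over a type that is merely of
  class \<open>field\<close>.
\<close>

fun poly_ord_at :: "'k::field p1_point \<Rightarrow> 'k poly \<Rightarrow> int" where
  "poly_ord_at Infinity a = - int (degree a)"
| "poly_ord_at (Affine p) a = int (GREATEST n. poly_of_monic_irred p ^ n dvd a)"

lemma monic_irred_power_dvd:
  assumes "a \<noteq> 0"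
  shows "\<exists>y. a = poly_of_monic_irred p ^ (GREATEST n. poly_of_monic_irred p ^ n dvd a) * y
           \<and> \<not> poly_of_monic_irred p dvd y"
proof -
  define q where "q = poly_of_monic_irred p"
  define n where "n = (GREATEST n. q ^ n dvd a)"
  have q: "irreducible q" using poly_of_monic_irred[of p] by (simp add: q_def)
  then have deg: "degree q > 0"
    by (metis irreducible_def is_unit_iff_degree gr0I)
  have bound: "m \<le> degree a" if "q ^ m dvd a" for m
  proof -
    have "degree (q ^ m) \<le> degree a" using that assms by (rule dvd_imp_degree_le)
    moreover have "degree (q ^ m) = m * degree q" using q by (intro degree_power_eq) auto
    ultimately show ?thesis using deg
      by (metis le_trans mult.right_neutral mult_le_mono2 Suc_leI One_nat_def)
  qed
  have "q ^ n dvd a"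
    unfolding n_def by (rule GreatestI_nat[where k = 0 and b = "degree a"]) (use bound in auto)
  then obtain y where y: "a = q ^ n * y" by blast
  have "\<not> q dvd y"
  proof
    assume "q dvd y"
    then have "q ^ Suc n dvd a" using y
      by (metis mult_dvd_mono dvd_refl mult.commute power_Suc)
    then have "Suc n \<le> n"
      unfolding n_def by (rule Greatest_le_nat[where b = "degree a"]) (use bound in auto)
    then show False by simp
  qed
  then show ?thesis using y unfolding n_def q_def by blast
qed

lemma monic_irred_Greatest_eqI:
  assumes "a = poly_of_monic_irred p ^ n * y" "\<not> poly_of_monic_irred p dvd y"
  shows "(GREATEST n. poly_of_monic_irred p ^ n dvd a) = n"
proof (rule Greatest_equality)
  show "poly_of_monic_irred p ^ n dvd a" using assms by simp
next
  fix m assume m: "poly_of_monic_irred p ^ m dvd a"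
  have nz: "poly_of_monic_irred p \<noteq> 0"
    using poly_of_monic_irred[of p] by auto
  show "m \<le> n"
  proof (rule ccontr)
    assume "\<not> m \<le> n"
    then have "poly_of_monic_irred p ^ Suc n dvd a"
      using m by (meson dvd_trans le_imp_power_dvd not_less_eq_eq)
    then have "poly_of_monic_irred p ^ n * poly_of_monic_irred p dvd poly_of_monic_irred p ^ n * y"
      using assms(1) by (simp add: mult.commute)
    then show False using nz assms(2) by simp
  qed
qed

lemma poly_ord_at_mult:
  assumes "a \<noteq> 0" "b \<noteq> 0"
  shows "poly_ord_at P (a * b) = poly_ord_at P a + poly_ord_at P b"
proof (cases P)
  case Infinity
  then show ?thesis using assms by (simp add: degree_mult_eq)
next
  case (Affine p)
  let ?q = "poly_of_monic_irred p"
  define m where "m = (GREATEST n. ?q ^ n dvd a)"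
  define n where "n = (GREATEST n. ?q ^ n dvd b)"
  obtain y z where y: "a = ?q ^ m * y" "\<not> ?q dvd y" and z: "b = ?q ^ n * z" "\<not> ?q dvd z"
    using monic_irred_power_dvd[OF assms(1)] monic_irred_power_dvd[OF assms(2)]
    unfolding m_def n_def by blast
  have "prime_elem ?q"
    using poly_of_monic_irred[of p] by (intro field_poly_irreducible_imp_prime) auto
  then have "\<not> ?q dvd y * z"
    using y(2) z(2) by (simp add: prime_elem_dvd_mult_iff)
  moreover have "a * b = ?q ^ (m + n) * (y * z)"
    by (subst y(1), subst z(1)) (simp add: power_add mult_ac)
  ultimately have "(GREATEST n. ?q ^ n dvd a * b) = m + n"
    by (intro monic_irred_Greatest_eqI)
  then show ?thesis using Affine by (simp add: m_def n_def)
qed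

text \<open>
  Order of vanishing at a point; it does not depend on the representation as a fraction, see
  \<open>ord_at_Fract\<close>. The value at the zero function is a dummy.
\<close>

definition ord_at :: "'k::field p1_point \<Rightarrow> 'k ratfun \<Rightarrow> int" where
  "ord_at P f = (if f = 0 then 0 else
     (THE n. \<exists>a b. a \<noteq> 0 \<and> b \<noteq> 0 \<and> f = Fraction_Field.Fract a b
                  \<and> n = poly_ord_at P a - poly_ord_at P b))"

lemma ord_at_Fract:
  assumes "a \<noteq> 0" "b \<noteq> 0"
  shows "ord_at P (Fraction_Field.Fract a b) = poly_ord_at P a - poly_ord_at P b"
proof -
  have "poly_ord_at P a' - poly_ord_at P b' = poly_ord_at P a - poly_ord_at P b"
    if "a' \<noteq> 0" "b' \<noteq> 0" "Fraction_Field.Fract a b = Fraction_Field.Fract a' b'" for a' b'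
  proof -
    have "a * b' = a' * b"
      using that assms by (simp add: eq_fract)
    then show ?thesis
      using that assms poly_ord_at_mult[of a b' P] poly_ord_at_mult[of a' b P] by simp
  qed
  moreover have "Fraction_Field.Fract a b \<noteq> 0"
    using assms by (simp add: Zero_fract_def eq_fract)
  moreover have "(THE n. \<exists>a' b'. a' \<noteq> 0 \<and> b' \<noteq> 0
      \<and> Fraction_Field.Fract a b = Fraction_Field.Fract a' b'
      \<and> n = poly_ord_at P a' - poly_ord_at P b') = poly_ord_at P a - poly_ord_at P b"
    by (rule the_equality) (use assms calculation(1) in blast)+
  ultimately show ?thesis
    by (simp only: ord_at_def if_False)
qed

definition H0 :: "('k::field p1_point \<Rightarrow>\<^sub>0 int) \<Rightarrow> 'k ratfun set" where
  "H0 E = {f. f = 0 \<or> (\<forall>P. ord_at P f + Poly_Mapping.lookup E P \<ge> 0)}"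

definition floor_div :: "('k::field p1_point \<Rightarrow>\<^sub>0 rat) \<Rightarrow> 'k p1_point \<Rightarrow>\<^sub>0 int" where
  "floor_div D = Poly_Mapping.map floor D"

definition scale_div :: "nat \<Rightarrow> ('k::field p1_point \<Rightarrow>\<^sub>0 rat) \<Rightarrow> 'k p1_point \<Rightarrow>\<^sub>0 rat" where
  "scale_div n D = Poly_Mapping.map (\<lambda>x. of_nat n * x) D"

text \<open>The outer polynomial variable plays the role of the dummy variable \<open>u\<close>.\<close>

definition canonical_ring :: "('k::field p1_point \<Rightarrow>\<^sub>0 rat) \<Rightarrow> 'k ratfun poly set" where
  "canonical_ring D = {F. \<forall>n. coeff F n \<in> H0 (floor_div (scale_div n D))}"

definition coord_t :: "'k::field ratfun" where
  "coord_t = to_fract [:0, 1:]"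


section \<open>Presentations of subalgebras of \<open>k(t)[u]\<close>\<close>

definition scalar :: "'k::field \<Rightarrow> 'k ratfun poly" where
  "scalar c = [:to_fract [:c:]:]"

definition is_subalgebra :: "'k::field ratfun poly set \<Rightarrow> bool" where
  "is_subalgebra A \<longleftrightarrow>
     range scalar \<subseteq> A \<and> (\<forall>x\<in>A. \<forall>y\<in>A. x + y \<in> A) \<and> (\<forall>x\<in>A. \<forall>y\<in>A. x * y \<in> A)"

text \<open>
  Polynomials in variables indexed by the natural numbers, as finitely supported functions from
  exponent vectors to coefficients. The ring in the variables of index at most \<open>r\<close> is a subset
  of this type, and ideals are taken relative to that subset.
\<close>

type_synonym 'k mpoly = "(nat \<Rightarrow>\<^sub>0 nat) \<Rightarrow>\<^sub>0 'k"

definition Var :: "nat \<Rightarrow> 'k::field mpoly" where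
  "Var i = Poly_Mapping.single (Poly_Mapping.single i 1) 1"

definition poly_ring :: "nat \<Rightarrow> 'k::field mpoly set" where
  "poly_ring r = {p. \<forall>m \<in> Poly_Mapping.keys p. Poly_Mapping.keys m \<subseteq> {..r}}"

definition subst :: "(nat \<Rightarrow> 'k::field ratfun poly) \<Rightarrow> 'k mpoly \<Rightarrow> 'k ratfun poly" where
  "subst f p = (\<Sum>m \<in> Poly_Mapping.keys p. scalar (Poly_Mapping.lookup p m) * (\<Prod>i \<in> Poly_Mapping.keys m. f i ^ Poly_Mapping.lookup m i))"

definition is_ideal :: "nat \<Rightarrow> 'k::field mpoly set \<Rightarrow> bool" where
  "is_ideal r I \<longleftrightarrow>
     I \<subseteq> poly_ring r \<and> 0 \<in> I \<and> (\<forall>p\<in>I. \<forall>q\<in>I. p + q \<in> I) \<and> (\<forall>p\<in>poly_ring r. \<forall>q\<in>I. p * q \<in> I)"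

text \<open>
  Here \<open>gen\<close> maps a set to the substructure it generates. No proper subfamily generates;
  in particular the family \<open>g\<close> is injective on \<open>I\<close>.
\<close>

definition minimally_generates ::
  "('a set \<Rightarrow> 'a set) \<Rightarrow> 'i set \<Rightarrow> ('i \<Rightarrow> 'a) \<Rightarrow> 'a set \<Rightarrow> bool" where
  "minimally_generates gen I g A \<longleftrightarrow> gen (g ` I) = A \<and> (\<forall>J. J \<subset> I \<longrightarrow> gen (g ` J) \<noteq> A)"

definition minimal_presentation ::
  "'k::field ratfun poly set \<Rightarrow> nat \<Rightarrow> (nat \<Rightarrow> 'k ratfun poly) \<Rightarrow> 'i set \<Rightarrow> ('i \<Rightarrow> 'k mpoly) \<Rightarrow> bool"
where
  "minimal_presentation S r f I g \<longleftrightarrow>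
     minimally_generates (\<lambda>X. is_subalgebra hull X) {..r} f S \<and>
     minimally_generates (\<lambda>X. is_ideal r hull X) I g {p \<in> poly_ring r. subst f p = 0}"


section \<open>Best lower approximations\<close>

definition best_lower_approx :: "real \<Rightarrow> int \<Rightarrow> int \<Rightarrow> bool" where
  "best_lower_approx \<alpha> c d \<longleftrightarrow>
     d > 0 \<and> of_int c / of_int d \<le> \<alpha> \<and>
     \<not> (\<exists>c' d'. d' > 0 \<and> of_int c / of_int d \<le> (of_int c' / of_int d' :: real) \<and>
               of_int c' / of_int d' \<le> \<alpha> \<and> d' < d)"

end

theory Submission
  imports Defs
begin

text \<open>
  The ring \<open>S\<^sub>D\<close> is spanned by the monomials \<open>t\<^sup>k u\<^sup>n\<close> with \<open>(k, n)\<close> in the cone \<open>0 \<le> k \<le> \<alpha> n\<close>.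
  The vectors \<open>v\<^sub>i = (c\<^sub>i, d\<^sub>i)\<close> are irreducible in this cone: if \<open>v\<^sub>i = x + y\<close>, one summand has at
  least the slope of \<open>v\<^sub>i\<close> and a smaller denominator. Neighbours \<open>v\<^sub>i, v\<^bsub>i+1\<^esub>\<close> form a lattice basis, so
  every point of the cone is a combination of two neighbours, in a unique way. Writing \<open>v\<^sub>i + v\<^sub>j\<close>
  like this gives the relations. They rewrite every monomial to one supported on two neighbouring
  variables, and uniqueness shows that there are no further relations. A relation with leading
  term \<open>x\<^sub>i x\<^sub>j\<close> cannot be omitted because no monomial of another relation divides \<open>x\<^sub>i x\<^sub>j\<close>.
\<close>

section \<open>Best lower approximations and lattice points in the cone\<close>

text \<open>Fractions are compared by cross multiplication, so that everything stays in the natural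
  numbers; \<alpha> is represented by \<open>c r / d r\<close>. The condition
  \<open>best_iff\<close> works in both directions: every v_i is a best lower approximation, and
  none is missing from the list. Completeness is what forces neighbours to span the lattice.\<close>

locale lower_approximations =
  fixes c d :: "nat \<Rightarrow> nat" and r :: nat
  assumes c_0: "c 0 = 0"
    and slope_less_Suc: "i < r \<Longrightarrow> c i * d (Suc i) < c (Suc i) * d i"
    and best_iff: "(\<exists>i\<le>r. p = c i \<and> q = d i) \<longleftrightarrow> q > 0 \<and> p * d r \<le> c r * q \<and>
      (\<forall>p' q'. 0 < q' \<and> q' < q \<and> p * q' \<le> p' * q \<longrightarrow> c r * q' < p' * d r)"
begin

definition cone :: "(nat \<times> nat) set" where
  "cone = {(p, q). p * d r \<le> c r * q}"

lemma best:
  assumes "i \<le> r"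
  shows "d i > 0" "c i * d r \<le> c r * d i"
    "0 < q \<Longrightarrow> q < d i \<Longrightarrow> c i * q \<le> p * d i \<Longrightarrow> c r * q < p * d r"
proof -
  have "\<exists>k\<le>r. c i = c k \<and> d i = d k" using assms by blast
  from iffD1[OF best_iff this]
  show "d i > 0" "c i * d r \<le> c r * d i"
    "0 < q \<Longrightarrow> q < d i \<Longrightarrow> c i * q \<le> p * d i \<Longrightarrow> c r * q < p * d r"
    by blast+
qed

lemmas d_pos = best(1)

lemma v_in_cone: "i \<le> r \<Longrightarrow> (c i, d i) \<in> cone"
  by (simp add: cone_def best(2))

text \<open>The minimality clause of best approximation, turned into a lower bound for the degrees
  of cone points.\<close>

lemma d_le_if_slope_ge:
  assumes "i \<le> r" "(p, q) \<in> cone" "q > 0" "c i * q \<le> p * d i"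
  shows "d i \<le> q"
proof (rule ccontr)
  assume "\<not> d i \<le> q"
  then have "c r * q < p * d r" using best(3)[OF assms(1), of q p] assms(3,4) by simp
  then show False using assms(2) by (simp add: cone_def)
qed

lemma zero_in_cone: "(0, 0) \<in> cone"
  by (simp add: cone_def)

lemma cone_add: "(p, q) \<in> cone \<Longrightarrow> (p', q') \<in> cone \<Longrightarrow> (p + p', q + q') \<in> cone"
  by (simp add: cone_def algebra_simps)

lemma cone_degree_0: "(p, 0) \<in> cone \<Longrightarrow> p = 0"
  using d_pos[of r] by (simp add: cone_def)

lemma cone_irreducible:
  assumes "i \<le> r" "(p, q) \<in> cone" "(p', q') \<in> cone" "p + p' = c i" "q + q' = d i"
  shows "(p, q) = (0, 0) \<or> (p', q') = (0, 0)"
proof (rule ccontr)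
  assume nz: "\<not> ?thesis"
  then have "q > 0" "q' > 0"
    using cone_degree_0 assms(2,3) by (auto intro!: Nat.gr0I)
  \<comment> \<open>Both sides equal \<open>c i * d i\<close>, so the two summands cannot both have
    smaller slope than v_i.\<close>
  have "c i * q + c i * q' = p * d i + p' * d i"
    by (simp flip: assms(4,5) add: algebra_simps)
  then consider "c i * q \<le> p * d i" | "c i * q' \<le> p' * d i" by linarith
  then show False
  proof cases
    case 1
    then have "d i \<le> q" using d_le_if_slope_ge assms \<open>q > 0\<close> by blast
    with assms \<open>q' > 0\<close> show ?thesis by simp
  next
    case 2
    then have "d i \<le> q'" using d_le_if_slope_ge assms \<open>q' > 0\<close> by blast
    with assms \<open>q > 0\<close> show ?thesis by simp
  qed
qed

text \<open>The point (0, 1) lies in the cone and has the same slope as v_0.\<close>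

lemma d_0: "d 0 = 1"
  using d_le_if_slope_ge[of 0 0 1] d_pos[of 0] c_0 by (simp add: cone_def)

lemma slope_less:
  assumes "i < j" "j \<le> r"
  shows "c i * d j < c j * d i"
proof -
  \<comment> \<open>Real quotients turn the chain of cross-multiplied inequalities into plain
    transitivity.\<close>
  have step: "real (c i) / real (d i) < real (c (Suc i)) / real (d (Suc i))" if "i < r" for i
    using slope_less_Suc[OF that] d_pos[of i] d_pos[of "Suc i"] that
    by (simp add: divide_simps) (metis of_nat_less_iff of_nat_mult)
  have "real (c i) / real (d i) < real (c j) / real (d j)"
    using assms
  proof (induction j)
    case (Suc j)
    then show ?case using step[of j] by (cases "i = j") auto
  qed simp
  then show ?thesis
    using d_pos[of i] d_pos[of j] assms
    by (simp add: divide_simps) (metis of_nat_less_iff of_nat_mult)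
qed

lemma slope_le:
  assumes "i \<le> j" "j \<le> r"
  shows "c i * d j \<le> c j * d i"
  using slope_less[of i j] assms by (cases "i = j") auto

section \<open>Consecutive approximations form a lattice basis\<close>

text \<open>Among the cone points steeper than v_i, take one of least degree and then of least
  \<open>p\<close>. It is a best lower approximation, hence equal to some v_k with k > i. Its slope
  is at least that of v_{i+1}, so its degree is at least \<open>d (Suc i)\<close>; since v_{i+1}
  also competes, the degrees agree.\<close>

lemma successor_minimal:
  assumes "i < r" "(p, q) \<in> cone" "c i * q < p * d i"
  shows "d (Suc i) \<le> q \<and> (q = d (Suc i) \<longrightarrow> c (Suc i) \<le> p)"
proof -
  define above where "above p q \<longleftrightarrow> (p, q) \<in> cone \<and> c i * q < p * d i" for p q
  define q0 where "q0 = (LEAST q. \<exists>p. above p q)"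
  define p0 where "p0 = (LEAST p. above p q0)"
  have above: "above p q" "above (c (Suc i)) (d (Suc i))"
    using assms v_in_cone[of "Suc i"] slope_less_Suc[of i] unfolding above_def by auto
  have "\<exists>p. above p q0"
    unfolding q0_def by (rule LeastI_ex) (use above in blast)
  then have min: "above p0 q0"
    unfolding p0_def by (rule LeastI_ex)
  have q0_le: "q0 \<le> q'" if "above p' q'" for p' q'
    unfolding q0_def by (rule Least_le) (use that in blast)
  have p0_le: "p0 \<le> p'" if "above p' q0" for p'
    unfolding p0_def by (rule Least_le) (use that in blast)
  have "q0 > 0"
    using min cone_degree_0[of p0] by (cases "q0 = 0") (auto simp: above_def)
  have no_better: "c r * q' < p' * d r" if "0 < q'" "q' < q0" "p0 * q' \<le> p' * q0" for p' q'
  proof (rule ccontr)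
    assume "\<not> c r * q' < p' * d r"
    \<comment> \<open>A fraction at least \<open>p0 / q0\<close> is still steeper than v_i; the
      factor \<open>q0\<close> is cancelled at the end.\<close>
    moreover have "c i * q' < p' * d i"
    proof -
      have "c i * q' * q0 < p0 * d i * q'"
        using min that(1) by (simp add: above_def mult_ac)
      also have "\<dots> = p0 * q' * d i"
        by (simp add: mult_ac)
      also have "\<dots> \<le> p' * d i * q0"
        using that(3) mult_right_mono[of "p0 * q'" "p' * q0" "d i"] by (simp add: mult_ac)
      finally show ?thesis by simp
    qed
    ultimately have "above p' q'" by (simp add: above_def cone_def)
    then show False using q0_le that(2) by fastforce
  qed
  have "q0 > 0 \<and> p0 * d r \<le> c r * q0 \<and>
      (\<forall>p' q'. 0 < q' \<and> q' < q0 \<and> p0 * q' \<le> p' * q0 \<longrightarrow> c r * q' < p' * d r)"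
    using \<open>q0 > 0\<close> min no_better unfolding above_def cone_def by auto
  then obtain k where k: "k \<le> r" "p0 = c k" "q0 = d k"
    using best_iff[of p0 q0] by blast
  have "i < k"
  proof (rule ccontr)
    assume "\<not> i < k"
    then show False
      using slope_le[of k i] k min assms(1) by (auto simp: above_def)
  qed
  then have le: "c (Suc i) * q0 \<le> p0 * d (Suc i)"
    using slope_le[of "Suc i" k] k by simp
  have "d (Suc i) \<le> q0"
    using d_le_if_slope_ge[of "Suc i" p0 q0] assms(1) min le \<open>q0 > 0\<close> by (simp add: above_def)
  then have q0: "q0 = d (Suc i)"
    using q0_le above(2) by (simp add: order_antisym)
  then have "c (Suc i) \<le> p0"
    using le d_pos[of "Suc i"] assms(1) by simp
  then show ?thesis
    using q0 q0_le[OF above(1)] p0_le[of p] above(1) by auto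
qed

text \<open>Dividing v_i by the gcd leaves a cone point of the same slope, whose degree cannot be
  smaller than \<open>d i\<close>.\<close>

lemma coprime_v:
  assumes "i \<le> r"
  shows "coprime (c i) (d i)"
proof -
  define g where "g = gcd (c i) (d i)"
  obtain p q where pq: "c i = g * p" "d i = g * q"
    using gcd_dvd1[of "c i" "d i"] gcd_dvd2[of "c i" "d i"] unfolding g_def by (elim dvdE)
  have pos: "g > 0" "q > 0" using d_pos[OF assms] pq by auto
  have "g * (p * d r) \<le> g * (c r * q)"
    using v_in_cone[OF assms] pq by (simp add: cone_def mult_ac)
  then have "(p, q) \<in> cone" using pos by (simp add: cone_def)
  then have "d i \<le> q"
    using d_le_if_slope_ge[OF assms, of p q] pos pq by simp
  then have "g * q \<le> 1 * q" using pq by simp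
  then have "g \<le> 1" using pos by simp
  then have "g = 1" using pos by simp
  then show ?thesis unfolding g_def coprime_iff_gcd_eq_1 .
qed

text \<open>Let \<open>n\<close> be the determinant of v_i and v_{i+1}. Bezout gives a lattice point
  (p, q) of determinant 1 with v_i, which can be shifted by multiples of v_i until it lies between
  v_i and v_{i+1} in slope and has degree at most \<open>d (Suc i)\<close>. By
  \<open>successor_minimal\<close> its degree is then \<open>d (Suc i)\<close> and \<open>p\<close>
  is at least \<open>c (Suc i)\<close>, which leaves only n = 1.\<close>

lemma unimodular:
  assumes "i < r"
  shows "c (Suc i) * d i = c i * d (Suc i) + 1"
proof -
  define x y x' y' where "x = int (c i)" and "y = int (d i)"
    and "x' = int (c (Suc i))" and "y' = int (d (Suc i))"
  define n where "n = x' * y - x * y'"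
  have "int (c i * d (Suc i)) < int (c (Suc i) * d i)"
    using slope_less_Suc[OF assms] by (simp only: of_nat_less_iff)
  then have "n > 0"
    by (simp add: n_def x_def y_def x'_def y'_def mult_ac)
  have pos: "y > 0" "y' > 0" "x \<ge> 0" "x' \<ge> 0"
    using d_pos[of i] d_pos[of "Suc i"] assms by (auto simp: x_def x'_def y_def y'_def)
  have "gcd x y = 1"
    using coprime_v[of i] assms by (simp add: x_def y_def)
  then obtain a b where ab: "a * x + b * y = 1"
    using bezout_int[of x y] by auto
  \<comment> \<open>Subtracting \<open>k\<close> times v_i from the Bezout solution (b, -a) reduces
    its determinant with v_{i+1} to the remainder \<open>m\<close>.\<close>
  define k where "k = - (b * y' + a * x') div n"
  define m where "m = - (b * y' + a * x') mod n"
  define p q where "p = b - k * x" and "q = - a - k * y"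
  have m: "0 \<le> m" "m \<le> n - 1" using \<open>n > 0\<close> by (auto simp: m_def)
  have "x' * q - p * y' = - (b * y' + a * x') - k * n"
    by (simp add: p_def q_def n_def algebra_simps)
  also have "\<dots> = m"
    unfolding k_def m_def by (rule minus_div_mult_eq_mod)
  finally have m_eq: "x' * q - p * y' = m" .
  have det1: "p * y - x * q = 1"
    using ab by (simp add: p_def q_def algebra_simps)
  \<comment> \<open>Cramer's rule, here and for \<open>p\<close> below: n (p, q) = m v_i +
    v_{i+1}.\<close>
  have "n * q = (x' * q - p * y') * y + (p * y - x * q) * y'"
    by (simp add: n_def algebra_simps)
  then have nq: "n * q = m * y + y'" unfolding m_eq det1 by simp
  have "n * p = (x' * q - p * y') * x + (p * y - x * q) * x'"
    by (simp add: n_def algebra_simps)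
  then have np: "n * p = m * x + x'" unfolding m_eq det1 by simp
  have "0 < n * q" using pos m unfolding nq by (simp add: add_nonneg_pos)
  then have "q > 0" using \<open>n > 0\<close> by (simp add: zero_less_mult_iff)
  have "0 \<le> n * p" using pos m unfolding np by simp
  then have "p \<ge> 0" using \<open>n > 0\<close> by (simp add: zero_le_mult_iff)
  obtain p' q' where p': "p = int p'" "q = int q'"
    using \<open>p \<ge> 0\<close> \<open>q > 0\<close> by (metis nonneg_int_cases less_imp_le)
  have le: "x * int (d r) \<le> int (c r) * y" "x' * int (d r) \<le> int (c r) * y'"
    using v_in_cone[of i] v_in_cone[of "Suc i"] assms
    unfolding cone_def x_def y_def x'_def y'_def
    by (auto simp flip: of_nat_mult)
  \<comment> \<open>A positive multiple of (p, q) is a nonnegative combination of two cone points,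
    so (p, q) is in the cone.\<close>
  have "n * (p * int (d r)) = m * (x * int (d r)) + x' * int (d r)"
    using np by (simp add: algebra_simps flip: mult.assoc)
  also have "\<dots> \<le> m * (int (c r) * y) + int (c r) * y'"
    by (intro add_mono mult_left_mono le m)
  also have "\<dots> = n * (int (c r) * q)"
    using nq by (simp add: algebra_simps flip: mult.assoc)
  finally have "p * int (d r) \<le> int (c r) * q"
    using \<open>n > 0\<close> by simp
  then have "(p', q') \<in> cone"
    unfolding cone_def p' by (simp flip: of_nat_mult)
  moreover have "int (c i * q') < int (p' * d i)"
    using det1 unfolding p' x_def y_def by simp
  then have "c i * q' < p' * d i" by (simp only: of_nat_less_iff)
  ultimately have min: "d (Suc i) \<le> q'" "q' = d (Suc i) \<Longrightarrow> c (Suc i) \<le> p'"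
    using successor_minimal[OF assms, of p' q'] by simp_all
  have "d i \<le> d (Suc i)"
    using d_le_if_slope_ge[of i "c (Suc i)" "d (Suc i)"] v_in_cone[of "Suc i"] d_pos[of "Suc i"]
      slope_less_Suc[of i] assms by simp
  then have "y \<le> y'" by (simp add: y_def y'_def)
  \<comment> \<open>This uses that the remainder \<open>m\<close> is at most \<open>n - 1\<close>
    and that degrees do not decrease from v_i to v_{i+1}.\<close>
  have "n * q \<le> (n - 1) * y' + y'"
    unfolding nq using m \<open>y \<le> y'\<close> pos by (intro add_right_mono mult_mono) auto
  also have "\<dots> = n * y'" by (simp add: algebra_simps)
  finally have "q \<le> y'" using \<open>n > 0\<close> by simp
  then have "q = y'" "x' \<le> p"
    using min by (auto simp: p' y'_def x'_def)
  then have "n \<le> p * y - x * q"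
    unfolding n_def using pos by simp
  then have "n = 1" using det1 \<open>n > 0\<close> by simp
  then have "int (c (Suc i) * d i) = int (c i * d (Suc i) + 1)"
    by (simp add: n_def x_def y_def x'_def y'_def)
  then show ?thesis by (simp only: of_nat_eq_iff)
qed

section \<open>Decomposition of cone points along two neighbours\<close>

text \<open>Cramer's rule with determinant 1; the two inequalities say that the coordinates are
  nonnegative, so the natural subtractions do not truncate. The formulas for \<open>a\<close> and
  \<open>b\<close> are exported because \<open>pair_relation\<close> needs to determine when they
  vanish.\<close>

lemma cone_section:
  assumes "h < r" "c h * q \<le> p * d h" "p * d (Suc h) \<le> c (Suc h) * q"
  obtains a b where "p = a * c h + b * c (Suc h)" "q = a * d h + b * d (Suc h)"
    "a = c (Suc h) * q - p * d (Suc h)" "b = p * d h - c h * q"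
proof -
  define a b where "a = c (Suc h) * q - p * d (Suc h)" and "b = p * d h - c h * q"
  have a: "int a = int (c (Suc h)) * int q - int p * int (d (Suc h))"
    and b: "int b = int p * int (d h) - int (c h) * int q"
    using assms by (simp_all add: a_def b_def of_nat_diff)
  have det: "int (c (Suc h)) * int (d h) = int (c h) * int (d (Suc h)) + 1"
    using arg_cong[OF unimodular[OF assms(1)], of int] by simp
  have "int a * int (c h) + int b * int (c (Suc h))
      = int p * (int (c (Suc h)) * int (d h) - int (c h) * int (d (Suc h)))"
    unfolding a b by (simp add: algebra_simps)
  then have "int p = int (a * c h + b * c (Suc h))" unfolding det by simp
  then have p_eq: "p = a * c h + b * c (Suc h)" by (simp only: of_nat_eq_iff)
  have "int a * int (d h) + int b * int (d (Suc h))
      = int q * (int (c (Suc h)) * int (d h) - int (c h) * int (d (Suc h)))"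
    unfolding a b by (simp add: algebra_simps)
  then have "int q = int (a * d h + b * d (Suc h))" unfolding det by simp
  then have q_eq: "q = a * d h + b * d (Suc h)" by (simp only: of_nat_eq_iff)
  show ?thesis by (rule that[OF p_eq q_eq a_def b_def])
qed

text \<open>A discrete intermediate value argument; it finds the neighbours whose slopes enclose a
  given slope.\<close>

lemma sign_change:
  assumes "i < j" "\<not> P i" "P j"
  obtains h :: nat where "i \<le> h" "h < j" "\<not> P h" "P (Suc h)"
proof -
  have "\<exists>h. i \<le> h \<and> h < j \<and> \<not> P h \<and> P (Suc h)"
    using assms
  proof (induction j)
    case (Suc j)
    show ?case
    proof (cases "P j")
      case True
      then have "i < j" using Suc.prems by (metis less_Suc_eq)
      then show ?thesis using Suc.IH Suc.prems True by (metis less_Suc_eq)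
    next
      case False
      then show ?thesis using Suc.prems by (intro exI[of _ j]) auto
    qed
  qed simp
  then show ?thesis using that by blast
qed

text \<open>If h = r, then \<open>Suc h\<close> is not an index, so its coefficient has to vanish.
  This happens only for r = 0, where the cone is the ray through v_0 = (0, 1).\<close>

lemma cone_generated:
  assumes "(p, q) \<in> cone"
  obtains h a b where "h \<le> r" "p = a * c h + b * c (Suc h)" "q = a * d h + b * d (Suc h)"
    "h = r \<longrightarrow> b = 0"
proof (cases "p = 0")
  case True
  then show ?thesis using that[of 0 q 0] c_0 d_0 by simp
next
  case False
  have yr: "p * d r \<le> c r * q" using assms by (simp add: cone_def)
  have n0: "\<not> p * d 0 \<le> c 0 * q" using c_0 d_0 False by simp
  then have "0 < r" using yr by (cases r) auto
  then obtain h where "h < r" "\<not> p * d h \<le> c h * q" "p * d (Suc h) \<le> c (Suc h) * q"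
    by (rule sign_change[where P = "\<lambda>k. p * d k \<le> c k * q", OF _ n0 yr])
  then have h: "h < r" "c h * q \<le> p * d h" "p * d (Suc h) \<le> c (Suc h) * q" by auto
  obtain a b where "p = a * c h + b * c (Suc h)" "q = a * d h + b * d (Suc h)"
    by (rule cone_section[OF h]) blast
  then show ?thesis by (intro that[of h a b]) (use h(1) in auto)
qed

text \<open>The sum v_i + v_j is expanded in the sector that contains it, and determinants show that
  the sector lies strictly between i and j. The bound \<open>a \<ge> 2\<close> excludes a single
  variable on the right; it is needed again when the relations are shown to be minimal.\<close>

lemma pair_relation:
  assumes "i + 2 \<le> j" "j \<le> r"
  obtains h a b where "i < h" "h < j" "a > 0" "h + 1 < j \<or> b = 0" "b = 0 \<longrightarrow> a \<ge> 2"
    "c i + c j = a * c h + b * c (Suc h)" "d i + d j = a * d h + b * d (Suc h)"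
proof -
  let ?p = "c i + c j" and ?q = "d i + d j"
  have ij: "c i * d j < c j * d i" using slope_less[of i j] assms by simp
  have uni: "c (Suc i) * d i = c i * d (Suc i) + 1" using unimodular[of i] assms by simp
  \<comment> \<open>The determinant of v_{i+1} with v_i is -1 and with v_j at least 1, so with the
    sum it is nonnegative: the sum does not lie below v_{i+1}.\<close>
  have "c (Suc i) * d j < c j * d (Suc i)" using slope_less[of "Suc i" j] assms by simp
  then have "c (Suc i) * ?q \<le> ?p * d (Suc i)" using uni by (simp add: algebra_simps)
  then have ni: "\<not> ?p * d (Suc i) < c (Suc i) * ?q" by simp
  have yj: "?p * d j < c j * ?q" using ij by (simp add: algebra_simps)
  have "Suc i < j" using assms(1) by simp
  \<comment> \<open>The strict predicate puts a sum on the ray of some v_h into the sector that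
    starts there, so that \<open>a\<close> is positive.\<close>
  then obtain h where "Suc i \<le> h" "h < j" "\<not> ?p * d h < c h * ?q"
    "?p * d (Suc h) < c (Suc h) * ?q"
    by (rule sign_change[where P = "\<lambda>k. ?p * d k < c k * ?q", OF _ ni yj])
  then have h: "Suc i \<le> h" "h < j" "c h * ?q \<le> ?p * d h"
    "?p * d (Suc h) < c (Suc h) * ?q" by simp_all
  have "h < r" using h assms by simp
  obtain a b where ab: "?p = a * c h + b * c (Suc h)" "?q = a * d h + b * d (Suc h)"
    "a = c (Suc h) * ?q - ?p * d (Suc h)" "b = ?p * d h - c h * ?q"
    by (rule cone_section[OF \<open>h < r\<close> h(3) less_imp_le[OF h(4)]])
  have "i < h" using h by simp
  have "a > 0" using h ab(3) by simp
  \<comment> \<open>Here v_j contributes 1 to the determinant with v_h, and v_i contributes at most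
    -1.\<close>
  have b: "b = 0" if "Suc h = j"
  proof -
    have "c j * d h = c h * d j + 1" using unimodular[OF \<open>h < r\<close>] that by simp
    moreover have "c i * d h < c h * d i" using slope_less[of i h] \<open>i < h\<close> \<open>h < r\<close> by simp
    ultimately have "?p * d h \<le> c h * ?q"
      unfolding add_mult_distrib add_mult_distrib2 by linarith
    then show ?thesis unfolding ab(4) by (rule diff_is_0_eq[THEN iffD2])
  qed
  \<comment> \<open>Otherwise v_h = v_i + v_j, against irreducibility.\<close>
  have a: "a \<ge> 2" if "b = 0"
  proof (rule ccontr)
    assume "\<not> a \<ge> 2"
    then have "a = 1" using \<open>a > 0\<close> by simp
    then have "(c i, d i) = (0, 0) \<or> (c j, d j) = (0, 0)"
      using cone_irreducible[of h "c i" "d i" "c j" "d j"] v_in_cone[of i] v_in_cone[of j]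
        ab(1,2) that assms \<open>h < r\<close> by simp
    then show False using d_pos[of i] d_pos[of j] assms by auto
  qed
  have "h + 1 < j \<or> b = 0" using b h(2) by (cases "Suc h = j") auto
  then show ?thesis
    by (rule that[of h a b, rotated 3]) (use \<open>i < h\<close> h(2) \<open>a > 0\<close> a ab(1,2) in auto)
qed

end

section \<open>The canonical ring as a span of monomials\<close>

lemma monic_irred_dvd_exists:
  fixes b :: "'k::field poly"
  assumes "degree b > 0"
  obtains p where "poly_of_monic_irred p dvd b"
  using assms
proof (induction "degree b" arbitrary: b thesis rule: less_induct)
  case less
  show ?case
  proof (cases "irreducible b")
    case True
    define q where "q = smult (inverse (lead_coeff b)) b"
    have "b \<noteq> 0" using less.prems(2) by auto
    then have unit: "is_unit [:inverse (lead_coeff b):]" by (simp add: is_unit_iff_degree)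
    have q: "q = [:inverse (lead_coeff b):] * b" by (simp add: q_def)
    have "irreducible q"
      unfolding q irreducible_mult_unit_left[OF unit] by (rule True)
    moreover have "lead_coeff q = 1" using \<open>b \<noteq> 0\<close> by (simp add: q_def)
    ultimately have "poly_of_monic_irred (Abs_monic_irred q) = q"
      by (intro Abs_monic_irred_inverse) simp
    moreover have "q dvd b"
      unfolding q_def using \<open>b \<noteq> 0\<close> by (simp add: smult_dvd_iff)
    ultimately show ?thesis using less.prems(1) by metis
  next
    case False
    have "b \<noteq> 0" using less.prems(2) by auto
    then have "\<not> is_unit b" using less.prems(2) by (simp add: is_unit_iff_degree)
    with False \<open>b \<noteq> 0\<close> obtain x y where xy: "b = x * y" "\<not> is_unit x" "\<not> is_unit y"
      by (auto simp: irreducible_def)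
    then have "x \<noteq> 0" "y \<noteq> 0" using \<open>b \<noteq> 0\<close> by auto
    then have "degree x > 0" "degree y > 0" using xy by (auto simp: is_unit_iff_degree)
    moreover have "degree b = degree x + degree y"
      using xy \<open>x \<noteq> 0\<close> \<open>y \<noteq> 0\<close> by (simp add: degree_mult_eq)
    ultimately obtain p where "poly_of_monic_irred p dvd x"
      using less.hyps[of x] by auto
    then show ?thesis using less.prems(1) xy(1) by (meson dvd_mult2)
  qed
qed

lemma monic_irred_dvd_iff_ord_pos:
  assumes "a \<noteq> 0"
  shows "poly_of_monic_irred p dvd a \<longleftrightarrow> poly_ord_at (Affine p) a > 0"
proof -
  obtain y where y: "a = poly_of_monic_irred p ^ (GREATEST n. poly_of_monic_irred p ^ n dvd a) * y"
    "\<not> poly_of_monic_irred p dvd y"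
    using monic_irred_power_dvd[OF assms] by blast
  show ?thesis
  proof (cases "GREATEST n. poly_of_monic_irred p ^ n dvd a")
    case 0
    then show ?thesis using y by simp
  next
    case (Suc n)
    then have "poly_of_monic_irred p dvd a" using y by (metis dvd_mult2 dvd_triv_left power_Suc)
    then show ?thesis using Suc by simp
  qed
qed

text \<open>Absence of poles forces every irreducible factor of the denominator to divide the
  numerator too; cancelling it lowers the degree of the denominator.\<close>

lemma Fract_eq_to_fract_if_regular:
  fixes a b :: "'k::field poly"
  assumes "b \<noteq> 0" "\<And>p. ord_at (Affine p) (Fraction_Field.Fract a b) \<ge> 0"
  shows "\<exists>q. Fraction_Field.Fract a b = to_fract q"
  using assms
proof (induction "degree b" arbitrary: a b rule: less_induct)
  case less
  show ?case
  proof (cases "degree b = 0 \<or> a = 0")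
    case True
    then show ?thesis
    proof
      assume "degree b = 0"
      then obtain x where x: "b = [:x:]" by (rule degree_eq_zeroE)
      then have "Fraction_Field.Fract a b = to_fract (smult (inverse x) a)"
        using less.prems(1) by (simp add: to_fract_def eq_fract mult.commute)
      then show ?thesis by blast
    next
      assume "a = 0"
      then have "Fraction_Field.Fract a b = to_fract 0"
        using less.prems(1) by (simp add: to_fract_def eq_fract)
      then show ?thesis by blast
    qed
  next
    case False
    then have "degree b > 0" by simp
    then obtain p where p: "poly_of_monic_irred p dvd b"
      by (rule monic_irred_dvd_exists)
    let ?q = "poly_of_monic_irred p"
    have "irreducible ?q" using poly_of_monic_irred[of p] by simp
    then have q: "?q \<noteq> 0" "\<not> is_unit ?q" by (auto simp: irreducible_def)
    have "poly_ord_at (Affine p) a - poly_ord_at (Affine p) b \<ge> 0"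
      using less.prems(2)[of p] ord_at_Fract[of a b "Affine p"] False less.prems(1) by simp
    moreover have "poly_ord_at (Affine p) b > 0"
      using p less.prems(1) monic_irred_dvd_iff_ord_pos by blast
    ultimately have "?q dvd a"
      using False monic_irred_dvd_iff_ord_pos[of a p] by simp
    then obtain a' b' where ab: "a = ?q * a'" "b = ?q * b'" using p by (elim dvdE)
    then have nz: "a' \<noteq> 0" "b' \<noteq> 0" using False less.prems(1) by auto
    have eq: "Fraction_Field.Fract a b = Fraction_Field.Fract a' b'"
      unfolding ab using q nz by (simp add: eq_fract)
    have "degree b = degree ?q + degree b'"
      unfolding ab using q nz by (simp add: degree_mult_eq)
    moreover have "degree ?q > 0" using q by (auto simp: is_unit_iff_degree)
    ultimately show ?thesis
      using less.hyps[of b' a'] nz less.prems(2) unfolding eq by simp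
  qed
qed

lemma ord_at_to_fract:
  assumes "q \<noteq> 0"
  shows "ord_at P (to_fract q) = poly_ord_at P q"
proof -
  have "poly_ord_at P 1 = 0"
    using poly_ord_at_mult[of 1 1 P] by simp
  then show ?thesis using ord_at_Fract[of q 1 P] assms by (simp add: to_fract_def)
qed

text \<open>Regularity at the affine points leaves polynomials, and the order at infinity is minus
  the degree. The bound is put on the exponents that occur, so that the zero polynomial needs no
  exception.\<close>

lemma H0_single_Infinity:
  assumes "e \<ge> 0"
  shows "H0 (Poly_Mapping.single Infinity e)
    = {to_fract q | q :: 'k::field poly. \<forall>k. coeff q k \<noteq> 0 \<longrightarrow> int k \<le> e}"
proof (intro equalityI subsetI)
  fix f :: "'k ratfun"
  assume f: "f \<in> H0 (Poly_Mapping.single Infinity e)"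
  show "f \<in> {to_fract q | q. \<forall>k. coeff q k \<noteq> 0 \<longrightarrow> int k \<le> e}"
  proof (cases "f = 0")
    case True
    then have "f = to_fract 0" by simp
    then show ?thesis using coeff_0 by blast
  next
    case False
    then have ord: "ord_at P f + Poly_Mapping.lookup (Poly_Mapping.single Infinity e) P \<ge> 0" for P
      using f by (simp add: H0_def)
    obtain a b where ab: "f = Fraction_Field.Fract a b" "b \<noteq> 0"
      by (cases f) auto
    have "ord_at (Affine p) f \<ge> 0" for p
      using ord[of "Affine p"] by (simp add: lookup_single)
    then obtain q where q: "f = to_fract q"
      using Fract_eq_to_fract_if_regular[of b a] ab by auto
    then have "q \<noteq> 0" using False by auto
    then have "int (degree q) \<le> e"
      using ord[of Infinity] q by (simp add: ord_at_to_fract)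
    then show ?thesis using q le_degree by fastforce
  qed
next
  fix f :: "'k ratfun"
  assume "f \<in> {to_fract q | q. \<forall>k. coeff q k \<noteq> 0 \<longrightarrow> int k \<le> e}"
  then obtain q where q: "f = to_fract q" "\<forall>k. coeff q k \<noteq> 0 \<longrightarrow> int k \<le> e" by blast
  show "f \<in> H0 (Poly_Mapping.single Infinity e)"
  proof (cases "q = 0")
    case False
    then have "int (degree q) \<le> e" using q(2) by simp
    then have "ord_at P f + Poly_Mapping.lookup (Poly_Mapping.single Infinity e) P \<ge> 0" for P
      using False q(1) by (cases P) (auto simp: ord_at_to_fract lookup_single)
    then show ?thesis by (simp add: H0_def)
  qed (simp add: q(1) H0_def)
qed

section \<open>Subalgebras spanned by monomials\<close>

text \<open>A pair (k, n) stands for the monomial t^k u^n.\<close>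

definition monomial_span :: "(nat \<times> nat) set \<Rightarrow> 'k::field ratfun poly set" where
  "monomial_span M =
     {F. \<forall>n. \<exists>p. coeff F n = to_fract p \<and> (\<forall>k. coeff p k \<noteq> 0 \<longrightarrow> (k, n) \<in> M)}"

text \<open>The floor disappears because exponents are integers.\<close>

lemma canonical_ring_eq_monomial_span:
  assumes "\<alpha> \<ge> 0"
  shows "canonical_ring (Poly_Mapping.single (Infinity :: 'k::field p1_point) \<alpha>)
    = monomial_span {(k, n). of_nat k \<le> \<alpha> * of_nat n}"
proof -
  have div: "floor_div (scale_div n (Poly_Mapping.single (Infinity :: 'k p1_point) \<alpha>))
      = Poly_Mapping.single Infinity \<lfloor>\<alpha> * of_nat n\<rfloor>" for n
    by (simp add: floor_div_def scale_div_def mult.commute)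
  have "int k \<le> \<lfloor>\<alpha> * of_nat n\<rfloor> \<longleftrightarrow> of_nat k \<le> \<alpha> * of_nat n" for k n
    by (simp add: le_floor_iff)
  then show ?thesis
    using assms unfolding canonical_ring_def monomial_span_def div
    by (auto simp: H0_single_Infinity)
qed

lemma coord_t_power: "coord_t ^ k = to_fract (monom 1 k :: 'k::field poly)"
proof (induction k)
  case (Suc k)
  then show ?case
    by (simp add: coord_t_def monom_Suc flip: to_fract_mult)
qed (simp add: monom_0 one_pCons flip: to_fract_1)

lemma scalar_mult_monom: "scalar x * monom (coord_t ^ k) n = monom (to_fract (monom x k)) n"
  by (simp add: scalar_def coord_t_power smult_monom flip: to_fract_mult)

lemma is_subalgebra_monomial_span:
  fixes M :: "(nat \<times> nat) set"
  assumes zero: "(0, 0) \<in> M"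
    and add: "\<And>p q p' q'. (p, q) \<in> M \<Longrightarrow> (p', q') \<in> M \<Longrightarrow> (p + p', q + q') \<in> M"
  shows "is_subalgebra (monomial_span M :: 'k::field ratfun poly set)"
  unfolding is_subalgebra_def
proof (intro conjI ballI subsetI)
  fix F :: "'k ratfun poly"
  assume "F \<in> range scalar"
  then obtain x where F: "F = scalar x" by blast
  show "F \<in> monomial_span M"
    unfolding monomial_span_def mem_Collect_eq
  proof
    fix n
    show "\<exists>p. coeff F n = to_fract p \<and> (\<forall>k. coeff p k \<noteq> 0 \<longrightarrow> (k, n) \<in> M)"
      by (rule exI[of _ "if n = 0 then [:x:] else 0"])
        (use zero in \<open>auto simp: F scalar_def coeff_pCons split: nat.splits\<close>)
  qed
next
  fix F G :: "'k ratfun poly"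
  assume "F \<in> monomial_span M" "G \<in> monomial_span M"
  then obtain P Q where P: "\<And>n. coeff F n = to_fract (P n)"
      "\<And>n k. coeff (P n) k \<noteq> 0 \<Longrightarrow> (k, n) \<in> M"
    and Q: "\<And>n. coeff G n = to_fract (Q n)"
      "\<And>n k. coeff (Q n) k \<noteq> 0 \<Longrightarrow> (k, n) \<in> M"
    unfolding monomial_span_def mem_Collect_eq by metis
  show "F + G \<in> monomial_span M"
    unfolding monomial_span_def mem_Collect_eq
  proof
    fix n
    show "\<exists>p. coeff (F + G) n = to_fract p \<and> (\<forall>k. coeff p k \<noteq> 0 \<longrightarrow> (k, n) \<in> M)"
    proof (intro exI[of _ "P n + Q n"] conjI allI impI)
      fix k assume "coeff (P n + Q n) k \<noteq> 0"
      then have "coeff (P n) k \<noteq> 0 \<or> coeff (Q n) k \<noteq> 0" by auto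
      then show "(k, n) \<in> M" using P(2) Q(2) by blast
    qed (simp add: P Q)
  qed
  show "F * G \<in> monomial_span M"
    unfolding monomial_span_def mem_Collect_eq
  proof
    fix n
    show "\<exists>p. coeff (F * G) n = to_fract p \<and> (\<forall>k. coeff p k \<noteq> 0 \<longrightarrow> (k, n) \<in> M)"
    proof (intro exI[of _ "\<Sum>i\<le>n. P i * Q (n - i)"] conjI allI impI)
      show "coeff (F * G) n = to_fract (\<Sum>i\<le>n. P i * Q (n - i))"
        by (simp add: coeff_mult P Q)
    next
      fix k assume "coeff (\<Sum>i\<le>n. P i * Q (n - i)) k \<noteq> 0"
      then obtain i where i: "i \<le> n" "coeff (P i * Q (n - i)) k \<noteq> 0"
        unfolding coeff_sum by (auto elim: sum.not_neutral_contains_not_neutral)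
      then obtain j where j: "j \<le> k" "coeff (P i) j * coeff (Q (n - i)) (k - j) \<noteq> 0"
        unfolding coeff_mult by (auto elim: sum.not_neutral_contains_not_neutral)
      then have "(j, i) \<in> M" "(k - j, n - i) \<in> M" using P(2) Q(2) by auto
      then have "(j + (k - j), i + (n - i)) \<in> M" by (rule add)
      then show "(k, n) \<in> M" using i(1) j(1) by simp
    qed
  qed
qed

text \<open>The span determines \<open>M\<close>; minimality of the generators is proved by removing
  one point from \<open>M\<close>.\<close>

lemma monom_in_monomial_span_iff:
  "monom (coord_t ^ k) n \<in> (monomial_span M :: 'k::field ratfun poly set) \<longleftrightarrow> (k, n) \<in> M"
proof
  assume "monom (coord_t ^ k) n \<in> (monomial_span M :: 'k ratfun poly set)"
  then obtain p :: "'k poly" where "coord_t ^ k = to_fract p" "\<forall>k. coeff p k \<noteq> 0 \<longrightarrow> (k, n) \<in> M"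
    unfolding monomial_span_def mem_Collect_eq by (metis coeff_monom)
  then show "(k, n) \<in> M" by (auto simp: coord_t_power)
next
  assume M: "(k, n) \<in> M"
  show "monom (coord_t ^ k) n \<in> (monomial_span M :: 'k ratfun poly set)"
    unfolding monomial_span_def mem_Collect_eq
  proof
    fix n'
    show "\<exists>p :: 'k poly. coeff (monom (coord_t ^ k) n) n' = to_fract p \<and>
        (\<forall>k. coeff p k \<noteq> 0 \<longrightarrow> (k, n') \<in> M)"
      by (rule exI[of _ "if n' = n then monom 1 k else 0"])
        (use M in \<open>auto simp: coord_t_power split: if_splits\<close>)
  qed
qed

lemma sum_in_subalgebra:
  fixes A :: "'k::field ratfun poly set"
  assumes "is_subalgebra A" "\<And>x. x \<in> X \<Longrightarrow> f x \<in> A"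
  shows "sum f X \<in> A"
proof -
  have "scalar 0 \<in> A" using assms(1) unfolding is_subalgebra_def by blast
  then have "0 \<in> A" by (simp add: scalar_def)
  then show ?thesis using assms
    by (induction X rule: infinite_finite_induct) (auto simp: is_subalgebra_def)
qed

lemma power_in_subalgebra:
  fixes A :: "'k::field ratfun poly set"
  assumes "is_subalgebra A" "F \<in> A"
  shows "F ^ n \<in> A"
proof (induction n)
  case 0
  have "scalar 1 \<in> A" using assms(1) unfolding is_subalgebra_def by blast
  then show ?case by (simp add: scalar_def flip: one_pCons)
qed (use assms in \<open>auto simp: is_subalgebra_def\<close>)

lemma monomial_span_subset:
  fixes A :: "'k::field ratfun poly set"
  assumes A: "is_subalgebra A" and M: "\<And>k n. (k, n) \<in> M \<Longrightarrow> monom (coord_t ^ k) n \<in> A"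
  shows "monomial_span M \<subseteq> A"
proof
  fix F :: "'k ratfun poly"
  assume "F \<in> monomial_span M"
  then obtain P where P: "\<And>n. coeff F n = to_fract (P n)"
      "\<And>n k. coeff (P n) k \<noteq> 0 \<Longrightarrow> (k, n) \<in> M"
    unfolding monomial_span_def mem_Collect_eq by metis
  have "monom (coeff F n) n \<in> A" for n
  proof -
    have "P n = (\<Sum>k\<le>degree (P n). monom (coeff (P n) k) k)"
      by (rule poly_as_sum_of_monoms[symmetric])
    then have "monom (coeff F n) n = monom (to_fract (\<Sum>k\<le>degree (P n). monom (coeff (P n) k) k)) n"
      using P(1) by simp
    also have "\<dots> = (\<Sum>k\<le>degree (P n). scalar (coeff (P n) k) * monom (coord_t ^ k) n)"
      by (simp add: scalar_mult_monom monom_sum)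
    also have "\<dots> \<in> A"
    proof (rule sum_in_subalgebra[OF A])
      fix k
      have sc: "scalar x \<in> A" for x using A unfolding is_subalgebra_def by blast
      show "scalar (coeff (P n) k) * monom (coord_t ^ k) n \<in> A"
      \<comment> \<open>Exponents below the degree may lie outside \<open>M\<close>; their terms are
        zero.\<close>
      proof (cases "coeff (P n) k = 0")
        case True
        then show ?thesis using sc[of 0] by (simp add: scalar_def)
      next
        case False
        then show ?thesis using M P(2) sc A unfolding is_subalgebra_def by blast
      qed
    qed
    finally show ?thesis .
  qed
  then have "(\<Sum>n\<le>degree F. monom (coeff F n) n) \<in> A"
    by (intro sum_in_subalgebra[OF A])
  then show "F \<in> A" by (simp add: poly_as_sum_of_monoms)
qed

context lower_approximations
begin

text \<open>By irreducibility, the cone without v_i is still closed under addition. Its span is a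
  subalgebra that contains every generator except the one of index i.\<close>

lemma minimally_generates_cone:
  "minimally_generates (\<lambda>X. is_subalgebra hull X) {..r}
     (\<lambda>i. monom (coord_t ^ c i) (d i) :: 'k::field ratfun poly) (monomial_span cone)"
  (is "minimally_generates _ _ ?f _")
  unfolding minimally_generates_def
proof (intro conjI allI impI)
  have "is_subalgebra (monomial_span cone :: 'k ratfun poly set)"
    by (rule is_subalgebra_monomial_span) (auto intro: zero_in_cone cone_add)
  moreover have "monomial_span cone \<subseteq> A" if A: "?f ` {..r} \<subseteq> A" "is_subalgebra A" for A
  proof (rule monomial_span_subset[OF A(2)])
    fix k n assume "(k, n) \<in> cone"
    then obtain h a b where h: "h \<le> r" "k = a * c h + b * c (Suc h)" "n = a * d h + b * d (Suc h)"
      "h = r \<longrightarrow> b = 0"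
      by (rule cone_generated)
    have "monom (coord_t ^ k) n = ?f h ^ a * ?f (Suc h) ^ b"
      by (simp add: h(2,3) monom_power mult_monom power_add mult.commute flip: power_mult)
    moreover have "?f h ^ a \<in> A" using h(1) A by (intro power_in_subalgebra) auto
    moreover have "?f (Suc h) ^ b \<in> A"
    \<comment> \<open>For h = r the exponent \<open>b\<close> is 0 and the factor is 1, although
      \<open>Suc r\<close> is not the index of a generator.\<close>
    proof (cases "h = r")
      case True
      then show ?thesis using power_in_subalgebra[OF A(2), of "?f h" 0] A(1) h by auto
    next
      case False
      then show ?thesis using h(1) A by (intro power_in_subalgebra) auto
    qed
    ultimately show "monom (coord_t ^ k) n \<in> A" using A(2) unfolding is_subalgebra_def by metis
  qed
  ultimately show "is_subalgebra hull ?f ` {..r} = monomial_span cone"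
    by (intro hull_unique) (auto simp: monom_in_monomial_span_iff v_in_cone)
next
  fix J assume J: "J \<subset> {..r}"
  then obtain i where i: "i \<le> r" "i \<notin> J" by auto
  define M where "M = cone - {(c i, d i)}"
  have "is_subalgebra (monomial_span M :: 'k ratfun poly set)"
  proof (rule is_subalgebra_monomial_span)
    show "(0, 0) \<in> M" using d_pos[OF i(1)] zero_in_cone by (simp add: M_def)
  next
    fix p q p' q' assume "(p, q) \<in> M" "(p', q') \<in> M"
    then show "(p + p', q + q') \<in> M"
      using cone_irreducible[OF i(1), of p q p' q'] cone_add[of p q p' q']
      by (auto simp: M_def)
  qed
  moreover have "?f ` J \<subseteq> monomial_span M"
  proof
    fix F assume "F \<in> ?f ` J"
    then obtain j where j: "j \<in> J" "F = ?f j" by blast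
    then have "j \<le> r" "j \<noteq> i" using J i by auto
    then have "c j * d i \<noteq> c i * d j"
      using slope_less[of i j] slope_less[of j i] i(1) by (cases "i < j") auto
    then have "(c j, d j) \<in> M"
      using v_in_cone[OF \<open>j \<le> r\<close>] by (auto simp: M_def)
    then show "F \<in> monomial_span M" by (simp add: j monom_in_monomial_span_iff)
  qed
  ultimately have "is_subalgebra hull ?f ` J \<subseteq> monomial_span M"
    by (rule hull_minimal[rotated])
  moreover have "?f i \<notin> (monomial_span M :: 'k ratfun poly set)"
    by (simp add: monom_in_monomial_span_iff M_def)
  moreover have "?f i \<in> (monomial_span cone :: 'k ratfun poly set)"
    using i(1) by (simp add: monom_in_monomial_span_iff v_in_cone)
  ultimately show "is_subalgebra hull ?f ` J \<noteq> monomial_span cone" by blast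
qed

end

section \<open>The kernel of the presentation\<close>

lemma poly_mapping_sum_single: "p = (\<Sum>m\<in>Poly_Mapping.keys p. Poly_Mapping.single m (Poly_Mapping.lookup p m))"
proof (rule poly_mapping_eqI)
  fix k
  have "Poly_Mapping.lookup (\<Sum>m\<in>Poly_Mapping.keys p. Poly_Mapping.single m (Poly_Mapping.lookup p m)) k
      = (\<Sum>m\<in>Poly_Mapping.keys p. if k = m then Poly_Mapping.lookup p m else 0)"
    unfolding lookup_sum by (intro sum.cong) (auto simp: lookup_single when_def)
  also have "\<dots> = Poly_Mapping.lookup p k"
    by (simp add: in_keys_iff)
  finally show "Poly_Mapping.lookup p k
    = Poly_Mapping.lookup (\<Sum>m\<in>Poly_Mapping.keys p. Poly_Mapping.single m (Poly_Mapping.lookup p m)) k"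
    by simp
qed

lemma keys_add_nat: "Poly_Mapping.keys (m + m' :: 'a \<Rightarrow>\<^sub>0 nat) = Poly_Mapping.keys m \<union> Poly_Mapping.keys m'"
  by (auto simp: in_keys_iff lookup_add)

lemma scalar_0 [simp]: "scalar 0 = 0"
  and scalar_1 [simp]: "scalar 1 = 1"
  and scalar_add: "scalar (x + y) = scalar x + scalar y"
  and scalar_mult: "scalar (x * y) = scalar x * scalar y"
  by (simp_all add: scalar_def flip: one_pCons to_fract_add to_fract_mult)

definition power_product :: "(nat \<Rightarrow> 'a::comm_monoid_mult) \<Rightarrow> (nat \<Rightarrow>\<^sub>0 nat) \<Rightarrow> 'a" where
  "power_product f m = (\<Prod>i\<in>Poly_Mapping.keys m. f i ^ Poly_Mapping.lookup m i)"

text \<open>A larger index set gives exponent vectors with different supports a common range;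
  \<open>subst_superset\<close> and \<open>weight_superset\<close> serve the same purpose.\<close>

lemma power_product_superset:
  assumes "finite X" "Poly_Mapping.keys m \<subseteq> X"
  shows "power_product f m = (\<Prod>i\<in>X. f i ^ Poly_Mapping.lookup m i)"
  unfolding power_product_def
  by (rule prod.mono_neutral_left) (use assms in \<open>auto simp: in_keys_iff\<close>)

lemma power_product_add: "power_product f (m + m') = power_product f m * power_product f m'"
proof -
  let ?X = "Poly_Mapping.keys m \<union> Poly_Mapping.keys m'"
  have "power_product f (m + m') = (\<Prod>i\<in>?X. f i ^ Poly_Mapping.lookup (m + m') i)"
    by (rule power_product_superset) (auto simp: keys_add_nat)
  also have "\<dots> = (\<Prod>i\<in>?X. f i ^ Poly_Mapping.lookup m i) * (\<Prod>i\<in>?X. f i ^ Poly_Mapping.lookup m' i)"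
    by (simp add: lookup_add power_add prod.distrib)
  also have "\<dots> = power_product f m * power_product f m'"
    by (simp add: power_product_superset[where X = ?X])
  finally show ?thesis .
qed

lemma power_product_single [simp]: "power_product f (Poly_Mapping.single i a) = f i ^ a"
  by (cases "a = 0") (simp_all add: power_product_def)

lemma subst_superset:
  assumes "finite X" "Poly_Mapping.keys p \<subseteq> X"
  shows "subst f p = (\<Sum>m\<in>X. scalar (Poly_Mapping.lookup p m) * power_product f m)"
  unfolding subst_def power_product_def[symmetric]
  by (rule sum.mono_neutral_left) (use assms in \<open>auto simp: in_keys_iff\<close>)

lemma subst_single: "subst f (Poly_Mapping.single m a) = scalar a * power_product f m"
  by (cases "a = 0") (simp_all add: subst_def power_product_def)

lemma subst_add: "subst f (p + q) = subst f p + subst f q"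
proof -
  let ?X = "Poly_Mapping.keys p \<union> Poly_Mapping.keys q"
  have "subst f (p + q) = (\<Sum>m\<in>?X. scalar (Poly_Mapping.lookup (p + q) m) * power_product f m)"
    by (rule subst_superset) (use keys_add[of p q] in auto)
  also have "\<dots> = subst f p + subst f q"
    by (simp add: subst_superset[where X = ?X] lookup_add scalar_add ring_distribs sum.distrib)
  finally show ?thesis .
qed

lemma subst_0 [simp]: "subst f 0 = 0"
  by (simp add: subst_def)

lemma subst_sum: "subst f (sum p X) = (\<Sum>x\<in>X. subst f (p x))"
  by (induction X rule: infinite_finite_induct) (simp_all add: subst_add)

lemma subst_mult: "subst f (p * q) = subst f p * subst f q"
proof -
  let ?s = "\<lambda>p m. Poly_Mapping.single m (Poly_Mapping.lookup p m)"
  have "p * q = (\<Sum>m\<in>Poly_Mapping.keys p. ?s p m) * (\<Sum>m\<in>Poly_Mapping.keys q. ?s q m)"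
    by (simp flip: poly_mapping_sum_single)
  also have "subst f \<dots> = (\<Sum>m\<in>Poly_Mapping.keys p. subst f (?s p m)) * (\<Sum>m\<in>Poly_Mapping.keys q. subst f (?s q m))"
    by (simp add: sum_product subst_sum mult_single subst_single power_product_add scalar_mult mult_ac)
  also have "\<dots> = subst f p * subst f q"
    by (simp flip: subst_sum poly_mapping_sum_single)
  finally show ?thesis .
qed

lemma Var_power: "Var i ^ a = (Poly_Mapping.single (Poly_Mapping.single i a) 1 :: 'k::field mpoly)"
  by (induction a) (simp_all add: Var_def mult_single flip: single_add)

lemma poly_ring_add: "p \<in> poly_ring r \<Longrightarrow> q \<in> poly_ring r \<Longrightarrow> p + q \<in> poly_ring r"
  unfolding poly_ring_def using keys_add[of p q] by blast

lemma poly_ring_mult: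
  assumes "p \<in> poly_ring r" "q \<in> poly_ring r"
  shows "p * q \<in> poly_ring r"
  unfolding poly_ring_def
proof safe
  fix m i assume m: "m \<in> Poly_Mapping.keys (p * q)" "i \<in> Poly_Mapping.keys m"
  then obtain a b where "m = a + b" "a \<in> Poly_Mapping.keys p" "b \<in> Poly_Mapping.keys q"
    using keys_mult[of p q] by blast
  then show "i \<le> r" using m(2) assms by (auto simp: poly_ring_def keys_add_nat)
qed

lemma single_in_poly_ring: "Poly_Mapping.keys m \<subseteq> {..r} \<Longrightarrow> Poly_Mapping.single m a \<in> poly_ring r"
  by (auto simp: poly_ring_def split: if_splits)

lemma ideal_sum:
  assumes "is_ideal r I" "\<And>x. x \<in> X \<Longrightarrow> p x \<in> I"
  shows "sum p X \<in> I"
  using assms by (induction X rule: infinite_finite_induct) (auto simp: is_ideal_def)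

lemma is_ideal_kernel: "is_ideal r {p \<in> poly_ring r. subst f p = 0}"
  unfolding is_ideal_def
  by (auto simp: poly_ring_add poly_ring_mult subst_add subst_mult) (simp add: poly_ring_def)

text \<open>\<open>D\<close> is closed under divisors, so the monomials outside \<open>D\<close> are
  closed under multiples and span a monomial ideal. Such an ideal will separate one relation from
  all the others.\<close>

lemma is_ideal_avoiding:
  assumes "\<And>m m'. m + m' \<in> D \<Longrightarrow> m' \<in> D"
  shows "is_ideal r {p :: 'k::field mpoly. p \<in> poly_ring r \<and> Poly_Mapping.keys p \<inter> D = {}}"
  unfolding is_ideal_def
proof (intro conjI ballI)
  fix p q :: "'k mpoly"
  assume p: "p \<in> poly_ring r" and q: "q \<in> {p. p \<in> poly_ring r \<and> Poly_Mapping.keys p \<inter> D = {}}"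
  have "m \<notin> D" if "m \<in> Poly_Mapping.keys (p * q)" for m
  proof -
    from that obtain a b where ab: "m = a + b" "b \<in> Poly_Mapping.keys q"
      using keys_mult[of p q] by blast
    then show ?thesis using q assms[of a b] by blast
  qed
  then show "p * q \<in> {p. p \<in> poly_ring r \<and> Poly_Mapping.keys p \<inter> D = {}}"
    using p q by (auto intro: poly_ring_mult)
next
  fix p q :: "'k mpoly"
  assume "p \<in> {p. p \<in> poly_ring r \<and> Poly_Mapping.keys p \<inter> D = {}}"
    and "q \<in> {p. p \<in> poly_ring r \<and> Poly_Mapping.keys p \<inter> D = {}}"
  then show "p + q \<in> {p. p \<in> poly_ring r \<and> Poly_Mapping.keys p \<inter> D = {}}"
    using keys_add[of p q] by (auto intro: poly_ring_add)
qed (auto simp: poly_ring_def)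

section \<open>Bidegrees and the kernel\<close>

text \<open>For the generators at hand, \<open>weight c m\<close> and \<open>weight d m\<close> are
  the exponents of t and u in the image of the monomial with exponent vector
  \<open>m\<close>.\<close>

definition weight :: "(nat \<Rightarrow> nat) \<Rightarrow> (nat \<Rightarrow>\<^sub>0 nat) \<Rightarrow> nat" where
  "weight c m = (\<Sum>i\<in>Poly_Mapping.keys m. c i * Poly_Mapping.lookup m i)"

lemma weight_superset:
  assumes "finite X" "Poly_Mapping.keys m \<subseteq> X"
  shows "weight c m = (\<Sum>i\<in>X. c i * Poly_Mapping.lookup m i)"
  unfolding weight_def
  by (rule sum.mono_neutral_left) (use assms in \<open>auto simp: in_keys_iff\<close>)

lemma weight_add: "weight c (m + m') = weight c m + weight c m'"
  by (simp add: weight_superset[where X = "Poly_Mapping.keys m \<union> Poly_Mapping.keys m'"]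
    keys_add_nat lookup_add ring_distribs sum.distrib)

lemma weight_single [simp]: "weight c (Poly_Mapping.single i a) = c i * a"
  by (cases "a = 0") (simp_all add: weight_def)

lemma prod_monom: "(\<Prod>i\<in>X. monom (f i) (n i)) = monom (\<Prod>i\<in>X. f i) (\<Sum>i\<in>X. n i)"
  by (induction X rule: infinite_finite_induct) (simp_all add: mult_monom)

lemma power_product_monom:
  "power_product (\<lambda>i. monom (coord_t ^ c i) (d i)) m = monom (coord_t ^ weight c m) (weight d m)"
  by (simp add: power_product_def weight_def monom_power prod_monom power_sum mult.commute
    flip: power_mult)

text \<open>Every monomial maps to some t^k u^n, and these are linearly independent, so the kernel
  is described bidegree by bidegree.\<close>

lemma subst_monom_eq_0_iff:
  fixes p :: "'k::field mpoly"
  shows "subst (\<lambda>i. monom (coord_t ^ c i) (d i)) p = 0 \<longleftrightarrow>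
    (\<forall>k n. (\<Sum>m | m \<in> Poly_Mapping.keys p \<and> weight c m = k \<and> weight d m = n. Poly_Mapping.lookup p m) = 0)"
    (is "?F = 0 \<longleftrightarrow> _")
proof -
  let ?q = "\<lambda>n. \<Sum>m\<in>Poly_Mapping.keys p. if weight d m = n then monom (Poly_Mapping.lookup p m) (weight c m) else 0"
  have F: "?F = (\<Sum>m\<in>Poly_Mapping.keys p. monom (to_fract (monom (Poly_Mapping.lookup p m) (weight c m))) (weight d m))"
    by (simp add: subst_superset[where X = "Poly_Mapping.keys p"] power_product_monom scalar_mult_monom)
  have coeff_F: "coeff ?F n = to_fract (?q n)" for n
    unfolding F coeff_sum to_fract_sum by (intro sum.cong) auto
  have coeff_q: "coeff (?q n) k
      = (\<Sum>m | m \<in> Poly_Mapping.keys p \<and> weight c m = k \<and> weight d m = n. Poly_Mapping.lookup p m)" for n k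
    unfolding coeff_sum by (rule sum.mono_neutral_cong_right) auto
  have "?F = 0 \<longleftrightarrow> (\<forall>n. ?q n = 0)"
    unfolding poly_eq_iff[of ?F] coeff_F by (simp del: to_fract_sum)
  then show ?thesis unfolding poly_eq_iff[of "?q _"] coeff_q by auto
qed

lemma card_pairs: "card {(i, j). i + 2 \<le> j \<and> j \<le> r} = r choose 2"
proof (induction r)
  case 0
  have "{(i, j). i + 2 \<le> j \<and> j \<le> (0::nat)} = {}" by auto
  show ?case unfolding \<open>_ = {}\<close> by simp
next
  case (Suc r)
  \<comment> \<open>The new pairs have second entry \<open>Suc r\<close> and first entry below
    \<open>r\<close>, in accordance with Pascal's rule.\<close>
  have eq: "{(i, j). i + 2 \<le> j \<and> j \<le> Suc r}
      = {(i, j). i + 2 \<le> j \<and> j \<le> r} \<union> (\<lambda>i. (i, Suc r)) ` {..<r}"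
    by (auto simp: le_Suc_eq)
  have "finite {(i, j). i + 2 \<le> j \<and> j \<le> r}"
    by (rule finite_subset[of _ "{..r} \<times> {..r}"]) auto
  then have "card {(i, j). i + 2 \<le> j \<and> j \<le> Suc r}
      = (r choose 2) + card ((\<lambda>i. (i, Suc r)) ` {..<r})"
    unfolding eq Suc[symmetric] by (intro card_Un_disjoint) auto
  also have "card ((\<lambda>i. (i, Suc r)) ` {..<r}) = r"
    by (subst card_image) (auto intro: inj_onI)
  finally show ?case by (simp add: numeral_2_eq_2)
qed

section \<open>Normal forms and rewriting\<close>

text \<open>These are the normal forms: the monomials in the given variables that no x_i x_j with j
  at least i + 2 divides.\<close>

definition adjacent_support :: "nat \<Rightarrow> (nat \<Rightarrow>\<^sub>0 nat) \<Rightarrow> bool" where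
  "adjacent_support r m \<longleftrightarrow> Poly_Mapping.keys m \<subseteq> {..r} \<and> (\<exists>h. Poly_Mapping.keys m \<subseteq> {h, Suc h})"

lemma adjacent_supportE:
  assumes "adjacent_support r m"
  obtains h a b where "h \<le> r" "h = r \<longrightarrow> b = 0"
    "m = Poly_Mapping.single h a + Poly_Mapping.single (Suc h) b"
proof (cases "m = 0")
  case True
  then show ?thesis using that[of 0 0 0] by simp
next
  case False
  obtain h where h: "Poly_Mapping.keys m \<subseteq> {h, Suc h}" "Poly_Mapping.keys m \<subseteq> {..r}"
    using assms unfolding adjacent_support_def by blast
  obtain k where "k \<in> Poly_Mapping.keys m"
    using False by (metis in_keys_iff lookup_zero poly_mapping_eqI)
  then have "k \<in> {h, Suc h}" "k \<in> {..r}" using h by blast+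
  then have "h \<le> r" by auto
  moreover have "h = r \<longrightarrow> Poly_Mapping.lookup m (Suc h) = 0"
    using h by (auto simp flip: not_in_keys_iff_lookup_eq_zero)
  moreover have "m = Poly_Mapping.single h (Poly_Mapping.lookup m h)
      + Poly_Mapping.single (Suc h) (Poly_Mapping.lookup m (Suc h))"
  proof (rule poly_mapping_eqI)
    fix k
    have "Poly_Mapping.lookup m k = 0" if "k \<noteq> h" "k \<noteq> Suc h"
      using h(1) that by (auto simp flip: not_in_keys_iff_lookup_eq_zero)
    then show "Poly_Mapping.lookup m k = Poly_Mapping.lookup (Poly_Mapping.single h (Poly_Mapping.lookup m h)
      + Poly_Mapping.single (Suc h) (Poly_Mapping.lookup m (Suc h))) k"
      by (auto simp: lookup_add lookup_single when_def)
  qed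
  ultimately show ?thesis by (rule that)
qed

text \<open>The outer induction is on the length of an interval containing the support, the inner
  one on the exponent of its lowest variable. Trading the two end variables for a monomial supported
  strictly between them lowers that exponent; once either end is used up, the interval
  shrinks.\<close>

lemma reduce_to_adjacent_support:
  fixes I :: "'k::field mpoly set"
  assumes I: "is_ideal r I"
    and rel: "\<And>i j. i + 2 \<le> j \<Longrightarrow> j \<le> r \<Longrightarrow> \<exists>x. Poly_Mapping.keys x \<subseteq> {i<..<j} \<and>
      weight c x = c i + c j \<and> weight d x = d i + d j \<and>
      Poly_Mapping.single (Poly_Mapping.single i 1 + Poly_Mapping.single j 1) 1 - Poly_Mapping.single x 1 \<in> I"
    and m: "Poly_Mapping.keys m \<subseteq> {..r}" "Poly_Mapping.keys m \<subseteq> {i..i + n}"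
  shows "\<exists>m'. adjacent_support r m' \<and> weight c m' = weight c m \<and> weight d m' = weight d m \<and>
    Poly_Mapping.single m 1 - Poly_Mapping.single m' 1 \<in> I"
  using m
proof (induction n arbitrary: i m)
  case (0 i m)
  then have "adjacent_support r m" by (auto simp: adjacent_support_def)
  then show ?case using I by (intro exI[of _ m]) (simp add: is_ideal_def)
next
  case (Suc n i m)
  show ?case
  proof (cases "n = 0")
    case True
    then have "Poly_Mapping.keys m \<subseteq> {i, Suc i}" using Suc.prems(2) by auto
    then have "adjacent_support r m" using Suc.prems(1) unfolding adjacent_support_def by blast
    then show ?thesis using I by (intro exI[of _ m]) (simp add: is_ideal_def)
  next
    case False
    define j where "j = i + Suc n"
    show ?thesis
      using Suc.prems
    proof (induction "Poly_Mapping.lookup m i" arbitrary: m rule: less_induct)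
      case (less m)
      show ?case
      proof (cases "Poly_Mapping.lookup m i = 0 \<or> Poly_Mapping.lookup m j = 0")
        case True
        then show ?thesis
        proof
          assume "Poly_Mapping.lookup m i = 0"
          then have "i \<notin> Poly_Mapping.keys m" by (simp add: in_keys_iff)
          have "k \<in> {Suc i..Suc i + n}" if "k \<in> Poly_Mapping.keys m" for k
            using less.prems(2) that \<open>i \<notin> _\<close> by (cases "k = i") force+
          then have "Poly_Mapping.keys m \<subseteq> {Suc i..Suc i + n}" by blast
          then show ?thesis by (rule Suc.IH[OF less.prems(1)])
        next
          assume "Poly_Mapping.lookup m j = 0"
          then have "j \<notin> Poly_Mapping.keys m" by (simp add: in_keys_iff)
          have "k \<in> {i..i + n}" if "k \<in> Poly_Mapping.keys m" for k
            using less.prems(2) that \<open>j \<notin> _\<close> unfolding j_def by (cases "k = i + Suc n") force+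
          then have "Poly_Mapping.keys m \<subseteq> {i..i + n}" by blast
          then show ?thesis by (rule Suc.IH[OF less.prems(1)])
        qed
      next
        case nz: False
        then have "j \<in> Poly_Mapping.keys m" by (simp add: in_keys_iff)
        then have "j \<le> r" using less.prems(1) by auto
        have "i \<noteq> j" "i + 2 \<le> j" using False by (auto simp: j_def)
        let ?e = "Poly_Mapping.single i 1 + Poly_Mapping.single j (1::nat)"
        obtain x where x: "Poly_Mapping.keys x \<subseteq> {i<..<j}"
            "weight c x = c i + c j" "weight d x = d i + d j"
            "Poly_Mapping.single ?e 1 - Poly_Mapping.single x 1 \<in> I"
          using rel[OF \<open>i + 2 \<le> j\<close> \<open>j \<le> r\<close>] by blast
        \<comment> \<open>Both end exponents are positive, so this subtraction does not
          truncate.\<close>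
        define m0 where "m0 = m - ?e"
        have m_eq: "m = m0 + ?e"
          by (rule poly_mapping_eqI)
            (use nz \<open>i \<noteq> j\<close> in \<open>auto simp: m0_def lookup_add lookup_minus lookup_single when_def\<close>)
        have keys: "Poly_Mapping.keys m = Poly_Mapping.keys m0 \<union> {i, j}"
          unfolding m_eq by (auto simp: keys_add_nat)
        define m1 where "m1 = m0 + x"
        have "i \<notin> Poly_Mapping.keys x" using x(1) by auto
        then have "Poly_Mapping.lookup m1 i < Poly_Mapping.lookup m i"
          using \<open>i \<noteq> j\<close> by (simp add: m1_def m_eq lookup_add lookup_single in_keys_iff)
        moreover have "Poly_Mapping.keys m1 \<subseteq> {..r}"
          using keys less.prems(1) x(1) \<open>j \<le> r\<close> by (force simp: m1_def keys_add_nat)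
        moreover have "Poly_Mapping.keys m1 \<subseteq> {i..i + Suc n}"
          using keys less.prems(2) x(1) by (force simp: m1_def keys_add_nat j_def)
        ultimately obtain m' where m': "adjacent_support r m'" "weight c m' = weight c m1"
            "weight d m' = weight d m1" "Poly_Mapping.single m1 1 - Poly_Mapping.single m' 1 \<in> I"
          using less.hyps by blast
        have "Poly_Mapping.single m0 1 \<in> (poly_ring r :: 'k mpoly set)"
          using keys less.prems(1) by (intro single_in_poly_ring) blast
        then have "Poly_Mapping.single m0 1 * (Poly_Mapping.single ?e 1 - Poly_Mapping.single x 1) \<in> I"
          using x(4) I unfolding is_ideal_def by blast
        then have "Poly_Mapping.single m 1 - Poly_Mapping.single m1 1 \<in> I"
          by (simp add: right_diff_distrib mult_single m_eq m1_def)
        then have "(Poly_Mapping.single m 1 - Poly_Mapping.single m1 1)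
            + (Poly_Mapping.single m1 1 - Poly_Mapping.single m' 1) \<in> I"
          using m'(4) I unfolding is_ideal_def by blast
        then have "Poly_Mapping.single m 1 - Poly_Mapping.single m' 1 \<in> I" by simp
        moreover have "weight c m1 = weight c m" "weight d m1 = weight d m"
          using x(2,3) by (simp_all add: m1_def m_eq weight_add)
        ultimately show ?thesis using m'(1-3) by (intro exI[of _ m']) simp
      qed
    qed
  qed
qed

section \<open>Uniqueness of normal forms and the generation of the kernel\<close>

context lower_approximations
begin

text \<open>For h < h', the determinant with v_{h+1} is at most 0 on one side and at least 0 on the
  other. Both vanish, so the point lies on the ray of v_{h+1}, which determines its coefficients.
  For h = h' the two vectors are independent, or only one of them occurs.\<close>

lemma section_unique:
  assumes h: "h \<le> h'" "h' \<le> r" "h = r \<longrightarrow> b = 0" "h' = r \<longrightarrow> b' = 0"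
    and c_eq: "a * c h + b * c (Suc h) = a' * c h' + b' * c (Suc h')"
    and d_eq: "a * d h + b * d (Suc h) = a' * d h' + b' * d (Suc h')"
  shows "Poly_Mapping.single h a + Poly_Mapping.single (Suc h) b
    = Poly_Mapping.single h' a' + Poly_Mapping.single (Suc h') b'"
proof -
  define D where "D i j = int (c j) * int (d i) - int (c i) * int (d j)" for i j
  have cross: "int a * D k h + int b * D k (Suc h) = int a' * D k h' + int b' * D k (Suc h')" for k
  proof -
    have "int a * D k h + int b * D k (Suc h)
        = int (a * c h + b * c (Suc h)) * int (d k) - int (c k) * int (a * d h + b * d (Suc h))"
      by (simp add: D_def algebra_simps)
    also have "\<dots> = int (a' * c h' + b' * c (Suc h')) * int (d k)
        - int (c k) * int (a' * d h' + b' * d (Suc h'))"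
      unfolding c_eq d_eq ..
    also have "\<dots> = int a' * D k h' + int b' * D k (Suc h')"
      by (simp add: D_def algebra_simps)
    finally show ?thesis .
  qed
  have D_refl: "D i i = 0" for i by (simp add: D_def)
  have D_pos: "D i j > 0" if "i < j" "j \<le> r" for i j
    using slope_less[OF that] by (simp add: D_def flip: of_nat_mult)
  show ?thesis
  proof (cases "h = h'")
    case True
    have "b = b'"
    proof (cases "h = r")
      case False
      then have "D h (Suc h) > 0" using True h D_pos by simp
      then show ?thesis using cross[of h] True D_refl by simp
    qed (use True h in simp)
    moreover have "d h > 0" using True h d_pos by simp
    ultimately show ?thesis using d_eq True by simp
  next
    case False
    then have lt: "Suc h \<le> h'" "h < r" using h by auto
    have "D (Suc h) h < 0"
      using D_pos[of h "Suc h"] lt by (simp add: D_def)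
    then have l: "int a * D (Suc h) h \<le> 0" by (simp add: mult_nonneg_nonpos)
    have Dh': "D (Suc h) h' \<ge> 0"
      using D_pos[of "Suc h" h'] lt h D_refl by (cases "Suc h = h'") auto
    \<comment> \<open>If h' = r, then \<open>b'\<close> is 0 and the value of \<open>D\<close> at
      the index \<open>Suc r\<close> does not matter.\<close>
    have r: "int b' * D (Suc h) (Suc h') \<ge> 0" "b' > 0 \<Longrightarrow> int b' * D (Suc h) (Suc h') > 0"
      using D_pos[of "Suc h" "Suc h'"] lt h by (cases "b' = 0"; simp)+
    have eq: "int a * D (Suc h) h = int a' * D (Suc h) h' + int b' * D (Suc h) (Suc h')"
      using cross[of "Suc h"] D_refl by simp
    have "int a' * D (Suc h) h' \<ge> 0" using Dh' by simp
    then have "b' = 0" "int a * D (Suc h) h = 0" "int a' * D (Suc h) h' = 0"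
      using eq l r by (linarith | force)+
    then have "a = 0" using \<open>D (Suc h) h < 0\<close> by simp
    show ?thesis
    proof (cases "Suc h = h'")
      case True
      then have "b = a'"
        using d_eq \<open>a = 0\<close> \<open>b' = 0\<close> d_pos[of h'] h by simp
      then show ?thesis using True \<open>a = 0\<close> \<open>b' = 0\<close> by simp
    next
      case False
      then have "D (Suc h) h' > 0" using D_pos lt h by simp
      then have "a' = 0" using \<open>int a' * D (Suc h) h' = 0\<close> by simp
      then have "b = 0"
        using d_eq \<open>a = 0\<close> \<open>b' = 0\<close> d_pos[of "Suc h"] lt by simp
      then show ?thesis using \<open>a = 0\<close> \<open>a' = 0\<close> \<open>b' = 0\<close> by simp
    qed
  qed
qed

lemma adjacent_support_unique:
  assumes "adjacent_support r m" "adjacent_support r m'"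
    and "weight c m = weight c m'" "weight d m = weight d m'"
  shows "m = m'"
proof -
  obtain h a b where m: "h \<le> r" "h = r \<longrightarrow> b = 0"
    "m = Poly_Mapping.single h a + Poly_Mapping.single (Suc h) b"
    using assms(1) by (rule adjacent_supportE)
  obtain h' a' b' where m': "h' \<le> r" "h' = r \<longrightarrow> b' = 0"
    "m' = Poly_Mapping.single h' a' + Poly_Mapping.single (Suc h') b'"
    using assms(2) by (rule adjacent_supportE)
  have eq: "a * c h + b * c (Suc h) = a' * c h' + b' * c (Suc h')"
      "a * d h + b * d (Suc h) = a' * d h' + b' * d (Suc h')"
    using assms(3,4) by (simp_all add: m m' weight_add mult.commute)
  show ?thesis
  proof (cases "h \<le> h'")
    case True
    then show ?thesis unfolding m(3) m'(3) using m m' eq by (intro section_unique) auto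
  next
    case False
    then show ?thesis unfolding m(3) m'(3) using m m' eq
      by (intro section_unique[symmetric]) auto
  qed
qed

text \<open>Modulo \<open>I\<close>, each monomial equals a normal form of the same bidegree, and by
  uniqueness the bidegree determines this normal form. For \<open>p\<close> in the kernel the
  coefficients in each bidegree sum to 0, so the normal form of \<open>p\<close> is 0.\<close>

lemma kernel_subset_ideal:
  fixes I :: "'k::field mpoly set"
  assumes I: "is_ideal r I"
    and rel: "\<And>i j. i + 2 \<le> j \<Longrightarrow> j \<le> r \<Longrightarrow> \<exists>x. Poly_Mapping.keys x \<subseteq> {i<..<j} \<and>
      weight c x = c i + c j \<and> weight d x = d i + d j \<and>
      Poly_Mapping.single (Poly_Mapping.single i 1 + Poly_Mapping.single j 1) 1 - Poly_Mapping.single x 1 \<in> I"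
    and p: "p \<in> poly_ring r" "subst (\<lambda>i. monom (coord_t ^ c i) (d i)) p = 0"
  shows "p \<in> I"
proof -
  let ?K = "Poly_Mapping.keys p"
  have "\<forall>m\<in>?K. \<exists>m'. adjacent_support r m' \<and> weight c m' = weight c m \<and> weight d m' = weight d m \<and>
    Poly_Mapping.single m 1 - Poly_Mapping.single m' 1 \<in> I"
  proof
    fix m assume "m \<in> ?K"
    then have m: "Poly_Mapping.keys m \<subseteq> {..r}" using p(1) by (auto simp: poly_ring_def)
    then have m': "Poly_Mapping.keys m \<subseteq> {0..0 + r}" by auto
    show "\<exists>m'. adjacent_support r m' \<and> weight c m' = weight c m \<and> weight d m' = weight d m \<and>
        Poly_Mapping.single m 1 - Poly_Mapping.single m' 1 \<in> I"
      by (rule reduce_to_adjacent_support[OF I rel m m'])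
  qed
  then obtain N where N: "\<And>m. m \<in> ?K \<Longrightarrow> adjacent_support r (N m)"
    "\<And>m. m \<in> ?K \<Longrightarrow> weight c (N m) = weight c m" "\<And>m. m \<in> ?K \<Longrightarrow> weight d (N m) = weight d m"
    "\<And>m. m \<in> ?K \<Longrightarrow> Poly_Mapping.single m 1 - Poly_Mapping.single (N m) 1 \<in> I"
    by metis
  let ?s = "\<lambda>m. Poly_Mapping.single 0 (Poly_Mapping.lookup p m)"
  have "(\<Sum>m\<in>?K. Poly_Mapping.single (N m) (Poly_Mapping.lookup p m)) = 0"
  proof (rule poly_mapping_eqI)
    fix k
    have eq: "Poly_Mapping.lookup (\<Sum>m\<in>?K. Poly_Mapping.single (N m) (Poly_Mapping.lookup p m)) k
        = (\<Sum>m | m \<in> ?K \<and> N m = k. Poly_Mapping.lookup p m)"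
      unfolding lookup_sum by (rule sum.mono_neutral_cong_right) (auto simp: lookup_single when_def)
    also have "\<dots> = 0"
    proof (cases "\<exists>m0\<in>?K. N m0 = k")
      case True
      then obtain m0 where m0: "m0 \<in> ?K" "N m0 = k" by blast
      have "N m = k \<longleftrightarrow> weight c m = weight c m0 \<and> weight d m = weight d m0" if "m \<in> ?K" for m
        using adjacent_support_unique[of "N m" "N m0"] N that m0 by metis
      then have "{m. m \<in> ?K \<and> N m = k}
          = {m. m \<in> ?K \<and> weight c m = weight c m0 \<and> weight d m = weight d m0}"
        by blast
      then show ?thesis using p(2) by (simp add: subst_monom_eq_0_iff)
    next
      case False
      then have "{m. m \<in> ?K \<and> N m = k} = {}" by blast
      then show ?thesis by (simp only: sum.empty)
    qed
    finally show "Poly_Mapping.lookup (\<Sum>m\<in>?K. Poly_Mapping.single (N m) (Poly_Mapping.lookup p m)) k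
        = Poly_Mapping.lookup 0 k"
      by simp
  qed
  then have "p = (\<Sum>m\<in>?K. Poly_Mapping.single m (Poly_Mapping.lookup p m))
      - (\<Sum>m\<in>?K. Poly_Mapping.single (N m) (Poly_Mapping.lookup p m))"
    by (simp flip: poly_mapping_sum_single)
  \<comment> \<open>The factor \<open>?s m\<close> is a constant polynomial: its only possible
    exponent vector is 0.\<close>
  also have "\<dots> = (\<Sum>m\<in>?K. ?s m * (Poly_Mapping.single m 1 - Poly_Mapping.single (N m) 1))"
    by (simp add: right_diff_distrib mult_single sum_subtractf)
  also have "\<dots> \<in> I"
  proof (rule ideal_sum[OF I])
    fix m assume "m \<in> ?K"
    moreover have "?s m \<in> poly_ring r" by (rule single_in_poly_ring) simp
    ultimately show "?s m * (Poly_Mapping.single m 1 - Poly_Mapping.single (N m) 1) \<in> I"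
      using N(4) I unfolding is_ideal_def by blast
  qed
  finally show ?thesis .
qed

section \<open>Minimality of the relations\<close>

lemma kernel_minimally_generated:
  fixes H A B :: "nat \<Rightarrow> nat \<Rightarrow> nat"
  assumes HAB: "\<And>i j. i + 2 \<le> j \<Longrightarrow> j \<le> r \<Longrightarrow>
      i < H i j \<and> H i j < j \<and> A i j > 0 \<and> (H i j + 1 < j \<or> B i j = 0) \<and> (B i j = 0 \<longrightarrow> A i j \<ge> 2) \<and>
      c i + c j = A i j * c (H i j) + B i j * c (Suc (H i j)) \<and>
      d i + d j = A i j * d (H i j) + B i j * d (Suc (H i j))"
  shows "minimally_generates (\<lambda>X. is_ideal r hull X) {(i, j). i + 2 \<le> j \<and> j \<le> r}
    (\<lambda>(i, j). Var i * Var j - Var (H i j) ^ A i j * Var (H i j + 1) ^ B i j)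
    {p :: 'k::field mpoly. p \<in> poly_ring r \<and> subst (\<lambda>i. monom (coord_t ^ c i) (d i)) p = 0}"
  (is "minimally_generates ?hull ?P ?g ?K")
  unfolding minimally_generates_def
proof (intro conjI allI impI)
  define e where "e i j = Poly_Mapping.single i 1 + Poly_Mapping.single j (1::nat)" for i j :: nat
  define x where "x i j = Poly_Mapping.single (H i j) (A i j) + Poly_Mapping.single (Suc (H i j)) (B i j)"
    for i j
  have g: "?g (i, j) = Poly_Mapping.single (e i j) 1 - Poly_Mapping.single (x i j) 1" for i j
  proof -
    have "Var i * Var j = (Poly_Mapping.single (e i j) 1 :: 'k mpoly)"
      by (simp add: Var_def mult_single e_def)
    then show ?thesis by (simp add: Var_power mult_single x_def)
  qed
  have keys_x: "Poly_Mapping.keys (x i j) \<subseteq> {i<..<j}" if "i + 2 \<le> j" "j \<le> r" for i j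
    using HAB[OF that] by (auto simp: x_def keys_add_nat split: if_splits)
  have weights: "weight c (x i j) = c i + c j" "weight d (x i j) = d i + d j"
    if "i + 2 \<le> j" "j \<le> r" for i j
    using HAB[OF that] by (simp_all add: x_def weight_add mult.commute)
  have keys_g: "Poly_Mapping.keys (?g (i, j)) \<subseteq> {e i j, x i j}" for i j
    unfolding g by (auto simp: in_keys_iff lookup_minus lookup_single when_def split: if_splits)
  have in_ring: "?g (i, j) \<in> poly_ring r" if "i + 2 \<le> j" "j \<le> r" for i j
  proof -
    have "Poly_Mapping.keys (e i j) \<subseteq> {..r}" using that by (auto simp: e_def keys_add_nat)
    moreover have "Poly_Mapping.keys (x i j) \<subseteq> {..r}" using keys_x[OF that] that by auto
    ultimately show ?thesis using keys_g[of i j] unfolding poly_ring_def by blast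
  qed
  have "subst (\<lambda>i. monom (coord_t ^ c i) (d i)) (?g (i, j)) = 0" if "i + 2 \<le> j" "j \<le> r" for i j
  proof -
    let ?s = "subst (\<lambda>i. monom (coord_t ^ c i) (d i)) :: 'k mpoly \<Rightarrow> _"
    \<comment> \<open>Moving the second monomial to the left reduces the claim to additivity of
      \<open>subst\<close>.\<close>
    have "?s (?g (i, j)) + ?s (Poly_Mapping.single (x i j) 1) = ?s (Poly_Mapping.single (e i j) 1)"
      unfolding g by (simp flip: subst_add)
    moreover have "?s (Poly_Mapping.single (x i j) 1) = ?s (Poly_Mapping.single (e i j) 1)"
      by (simp add: subst_single power_product_monom weights[OF that]) (simp add: e_def weight_add)
    ultimately show ?thesis by simp
  qed
  then have sub: "?g ` ?P \<subseteq> ?K" using in_ring by auto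
  show "?hull (?g ` ?P) = ?K"
  proof (rule hull_unique[OF sub])
    show "is_ideal r ?K" by (rule is_ideal_kernel)
  next
    fix I :: "'k mpoly set"
    assume gI: "?g ` ?P \<subseteq> I" and I: "is_ideal r I"
    have rel: "\<exists>x. Poly_Mapping.keys x \<subseteq> {i<..<j} \<and>
      weight c x = c i + c j \<and> weight d x = d i + d j \<and>
      Poly_Mapping.single (Poly_Mapping.single i 1 + Poly_Mapping.single j 1) 1 - Poly_Mapping.single x 1 \<in> I"
      if "i + 2 \<le> j" "j \<le> r" for i j
    proof -
      have "(i, j) \<in> ?P" using that by simp
      then have "?g (i, j) \<in> I" using gI by blast
      then show ?thesis
        using keys_x[OF that] weights[OF that] unfolding g e_def by blast
    qed
    show "?K \<subseteq> I"
      using kernel_subset_ideal[OF I rel] by blast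
  qed
  fix J assume "J \<subset> ?P"
  then obtain i j where ij: "i + 2 \<le> j" "j \<le> r" "(i, j) \<notin> J" and J: "J \<subseteq> ?P" by auto
  \<comment> \<open>the divisors of \<open>x\<^sub>i x\<^sub>j\<close>, none of which occurs in another relation\<close>
  define D where "D = {m. \<exists>m'. m + m' = e i j}"
  have D_lookup: "Poly_Mapping.lookup m k \<le> (if k = i \<or> k = j then 1 else 0)" if "m \<in> D" for m k
  proof -
    obtain m' where "m + m' = e i j" using \<open>m \<in> D\<close> unfolding D_def by blast
    then have "Poly_Mapping.lookup m k \<le> Poly_Mapping.lookup (e i j) k"
      by (metis le_add1 lookup_add)
    then show ?thesis using ij(1) by (auto simp: e_def lookup_add lookup_single when_def split: if_splits)
  qed
  define I where "I = {p :: 'k mpoly. p \<in> poly_ring r \<and> Poly_Mapping.keys p \<inter> D = {}}"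
  have "is_ideal r I"
    unfolding I_def
  proof (rule is_ideal_avoiding)
    fix m m' assume "m + m' \<in> D"
    then obtain m'' where "m + m' + m'' = e i j" unfolding D_def by blast
    then have "m' + (m + m'') = e i j" by (simp add: add_ac)
    then show "m' \<in> D" unfolding D_def by blast
  qed
  moreover have "?g ` J \<subseteq> I"
  proof
    fix p assume "p \<in> ?g ` J"
    then obtain i' j' where ij': "(i', j') \<in> J" "p = ?g (i', j')" by auto
    then have P: "i' + 2 \<le> j'" "j' \<le> r" using J by auto
    \<comment> \<open>Otherwise i' and j' both lie in {i, j}, and their order forces the pairs to
      coincide.\<close>
    have "e i' j' \<notin> D"
    proof
      assume D: "e i' j' \<in> D"
      have "k = i \<or> k = j" if "k = i' \<or> k = j'" for k
        using D_lookup[OF D, of k] that by (auto simp: e_def lookup_add split: if_splits)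
      from this[of i'] this[of j'] have "i' = i \<and> j' = j" using P ij(1) by auto
      then show False using ij' ij(3) by simp
    qed
    \<comment> \<open>In a divisor of x_i x_j the exponent \<open>A i' j'\<close> would be 1. Then
      \<open>B i' j'\<close> is positive, and two consecutive indices would lie in {i, j}, although
      j is at least i + 2.\<close>
    moreover have "x i' j' \<notin> D"
    proof
      assume D: "x i' j' \<in> D"
      have h: "A i' j' > 0" "B i' j' = 0 \<longrightarrow> A i' j' \<ge> 2" using HAB[OF P] by blast+
      have "A i' j' \<le> (if H i' j' = i \<or> H i' j' = j then 1 else 0)"
        using D_lookup[OF D, of "H i' j'"] by (simp add: x_def lookup_add lookup_single)
      moreover have "B i' j' \<le> (if Suc (H i' j') = i \<or> Suc (H i' j') = j then 1 else 0)"
        using D_lookup[OF D, of "Suc (H i' j')"] by (simp add: x_def lookup_add lookup_single)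
      ultimately show False using h ij(1) by (auto split: if_splits)
    qed
    ultimately show "p \<in> I"
      using keys_g[of i' j'] in_ring[OF P] unfolding ij'(2) I_def by blast
  qed
  ultimately have "?hull (?g ` J) \<subseteq> I" by (intro hull_minimal)
  moreover have "?g (i, j) \<in> ?K" using sub ij by blast
  moreover have "?g (i, j) \<notin> I"
  proof -
    \<comment> \<open>This keeps the two terms of the relation from cancelling, so x_i x_j really
      occurs in it.\<close>
    have "e i j \<noteq> x i j"
    proof
      assume "e i j = x i j"
      then have "i \<in> Poly_Mapping.keys (x i j)" unfolding \<open>e i j = x i j\<close>[symmetric] by (simp add: e_def keys_add_nat)
      then show False using keys_x[OF ij(1,2)] by auto
    qed
    then have "e i j \<in> Poly_Mapping.keys (?g (i, j))"
      unfolding g by (simp add: in_keys_iff lookup_minus lookup_single)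
    moreover have "e i j \<in> D" unfolding D_def using add_0_right by blast
    ultimately show ?thesis unfolding I_def by blast
  qed
  ultimately show "?hull (?g ` J) \<noteq> ?K" by blast
qed

lemma minimal_presentation_cone:
  "\<exists>g :: nat \<Rightarrow> nat \<Rightarrow> 'k::field mpoly.
    minimal_presentation (monomial_span cone) r (\<lambda>i. monom (coord_t ^ c i) (d i))
      {(i, j). i + 2 \<le> j \<and> j \<le> r} (\<lambda>(i, j). g i j) \<and>
    (\<forall>i j. i + 2 \<le> j \<and> j \<le> r \<longrightarrow>
      (\<exists>h a. i < h \<and> h < j \<and> a > 0 \<and> g i j = Var i * Var j - Var h ^ a) \<or>
      (\<exists>h a b. i < h \<and> h + 1 < j \<and> a > 0 \<and> b > 0 \<and>
         g i j = Var i * Var j - Var h ^ a * Var (h + 1) ^ b))"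
proof -
  define R where "R i j h a b \<longleftrightarrow> i < h \<and> h < j \<and> a > 0 \<and> (h + 1 < j \<or> b = 0) \<and> (b = 0 \<longrightarrow> a \<ge> 2) \<and>
      c i + c j = a * c h + b * c (Suc h) \<and> d i + d j = a * d h + b * d (Suc h)" for i j h a b
  have "\<exists>h a b. R i j h a b" if "i + 2 \<le> j" "j \<le> r" for i j
  proof (rule pair_relation[OF that])
    fix h a b
    assume "i < h" "h < j" "a > 0" "h + 1 < j \<or> b = 0" "b = 0 \<longrightarrow> a \<ge> 2"
      "c i + c j = a * c h + b * c (Suc h)" "d i + d j = a * d h + b * d (Suc h)"
    then have "R i j h a b" unfolding R_def by (intro conjI)
    then show ?thesis by blast
  qed
  \<comment> \<open>One solution is chosen for each pair; whether \<open>B\<close> vanishes then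
    decides between the two forms of relation.\<close>
  then obtain H A B where "\<And>i j. i + 2 \<le> j \<Longrightarrow> j \<le> r \<Longrightarrow> R i j (H i j) (A i j) (B i j)"
    by metis
  note HAB = this[unfolded R_def]
  define g :: "nat \<Rightarrow> nat \<Rightarrow> 'k mpoly"
    where "g i j = Var i * Var j - Var (H i j) ^ A i j * Var (H i j + 1) ^ B i j" for i j
  show ?thesis
  proof (intro exI[of _ g] conjI allI impI)
    show "minimal_presentation (monomial_span cone) r (\<lambda>i. monom (coord_t ^ c i) (d i))
        {(i, j). i + 2 \<le> j \<and> j \<le> r} (\<lambda>(i, j). g i j)"
      unfolding minimal_presentation_def g_def
    proof (rule conjI[OF minimally_generates_cone])
      show "minimally_generates (\<lambda>X. is_ideal r hull X) {(i, j). i + 2 \<le> j \<and> j \<le> r}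
          (\<lambda>(i, j). Var i * Var j - Var (H i j) ^ A i j * Var (H i j + 1) ^ B i j)
          {p :: 'k mpoly. p \<in> poly_ring r \<and> subst (\<lambda>i. monom (coord_t ^ c i) (d i)) p = 0}"
        using HAB by (rule kernel_minimally_generated[where H = H and A = A and B = B])
    qed
  next
    fix i j assume "i + 2 \<le> j \<and> j \<le> r"
    then have "i + 2 \<le> j" "j \<le> r" by blast+
    from HAB[OF this] have h: "i < H i j \<and> H i j < j \<and> A i j > 0 \<and> (H i j + 1 < j \<or> B i j = 0)"
      by (elim conjE, intro conjI)
    show "(\<exists>h a. i < h \<and> h < j \<and> a > 0 \<and> g i j = Var i * Var j - Var h ^ a) \<or>
      (\<exists>h a b. i < h \<and> h + 1 < j \<and> a > 0 \<and> b > 0 \<and>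
         g i j = Var i * Var j - Var h ^ a * Var (h + 1) ^ b)"
    proof (cases "B i j = 0")
      case True
      then have "g i j = Var i * Var j - Var (H i j) ^ A i j" by (simp add: g_def)
      then show ?thesis using h by (intro disjI1 exI[of _ "H i j"] exI[of _ "A i j"]) simp
    next
      case False
      then show ?thesis
        using h unfolding g_def
        by (intro disjI2 exI[of _ "H i j"] exI[of _ "A i j"] exI[of _ "B i j"]) simp
    qed
  qed
qed

end

section \<open>The presentation of the canonical ring\<close>

text \<open>A competing fraction is at least \<open>p / q\<close>, hence nonnegative, so natural
  numerators and denominators suffice.\<close>

lemma best_lower_approx_iff:
  assumes "d > 0" "q > 0"
  shows "best_lower_approx (real c / real d) (int p) (int q) \<longleftrightarrow> p * d \<le> c * q \<and>
    (\<forall>p' q'. 0 < q' \<and> q' < q \<and> p * q' \<le> p' * q \<longrightarrow> c * q' < p' * d)"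
proof -
  have cmp: "real a / real b \<le> real a' / real b' \<longleftrightarrow> a * b' \<le> a' * b" if "b > 0" "b' > 0" for a b a' b'
    using that by (simp add: divide_simps flip: of_nat_mult)
  have "(\<exists>c' d'. d' > 0 \<and> real p / real q \<le> (of_int c' / of_int d' :: real) \<and>
      of_int c' / of_int d' \<le> real c / real d \<and> d' < int q)
    \<longleftrightarrow> (\<exists>p' q'. 0 < q' \<and> q' < q \<and> p * q' \<le> p' * q \<and> p' * d \<le> c * q')" (is "?L \<longleftrightarrow> ?R")
  proof
    assume ?L
    then obtain c' d' where c': "d' > 0" "real p / real q \<le> (of_int c' / of_int d' :: real)"
      "of_int c' / of_int d' \<le> real c / real d" "d' < int q" by blast
    have "0 \<le> real p / real q" by simp
    then have "(0::real) \<le> of_int c' / of_int d'" using c'(2) by linarith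
    then have "c' \<ge> 0" using c'(1) by (simp add: zero_le_divide_iff)
    then obtain p' q' where "c' = int p'" "d' = int q'"
      using c'(1) by (metis nonneg_int_cases less_imp_le)
    then show ?R using c' assms cmp[of q q' p p'] cmp[of q' d p' c] by auto
  next
    assume ?R
    then obtain p' q' where "0 < q'" "q' < q" "p * q' \<le> p' * q" "p' * d \<le> c * q'" by blast
    then show ?L using assms cmp[of q q' p p'] cmp[of q' d p' c]
      by (intro exI[of _ "int p'"] exI[of _ "int q'"]) auto
  qed
  moreover have "\<not> ?R \<longleftrightarrow> (\<forall>p' q'. 0 < q' \<and> q' < q \<and> p * q' \<le> p' * q \<longrightarrow> c * q' < p' * d)"
    by (meson not_le)
  ultimately show ?thesis
    unfolding best_lower_approx_def of_int_of_nat_eq using assms cmp[of q d p c] by simp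
qed

theorem theorem4:
  fixes \<alpha> :: rat and r :: nat and c d :: "nat \<Rightarrow> nat"
  assumes "\<alpha> \<ge> 0"
    and "real (c 0) / real (d 0) = 0"
    and "real (c r) / real (d r) = of_rat \<alpha>"
    and "\<forall>i<r. real (c i) / real (d i) < real (c (Suc i)) / real (d (Suc i))"
    and "{(int (c i), int (d i)) | i. i \<le> r} =
         {(p, q). best_lower_approx (of_rat \<alpha>) p q \<and> 0 \<le> p}"
  shows "\<exists>g :: nat \<Rightarrow> nat \<Rightarrow> 'k::field mpoly.
    minimal_presentation
      (canonical_ring (Poly_Mapping.single Infinity \<alpha>)) r (\<lambda>i. monom (coord_t ^ c i) (d i))
      {(i, j). i + 2 \<le> j \<and> j \<le> r} (\<lambda>(i, j). g i j) \<and>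
    card {(i, j). i + 2 \<le> j \<and> j \<le> r} = r choose 2 \<and>
    (\<forall>i j. i + 2 \<le> j \<and> j \<le> r \<longrightarrow>
      (\<exists>h a. i < h \<and> h < j \<and> a > 0 \<and> g i j = Var i * Var j - Var h ^ a) \<or>
      (\<exists>h a b. i < h \<and> h + 1 < j \<and> a > 0 \<and> b > 0 \<and>
         g i j = Var i * Var j - Var h ^ a * Var (h + 1) ^ b))"
proof -
  have mem: "(\<exists>i\<le>r. p = c i \<and> q = d i) \<longleftrightarrow> best_lower_approx (of_rat \<alpha>) (int p) (int q)" for p q
  proof -
    have "(\<exists>i\<le>r. p = c i \<and> q = d i) \<longleftrightarrow> (int p, int q) \<in> {(int (c i), int (d i)) | i. i \<le> r}"
      by auto
    also have "\<dots> \<longleftrightarrow> best_lower_approx (of_rat \<alpha>) (int p) (int q)"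
      unfolding assms(5) by simp
    finally show ?thesis .
  qed
  have d_pos: "d i > 0" if "i \<le> r" for i
  proof -
    have "best_lower_approx (of_rat \<alpha>) (int (c i)) (int (d i))"
      using that mem[of "c i" "d i"] by blast
    then show ?thesis by (simp add: best_lower_approx_def)
  qed
  interpret lower_approximations c d r
  proof
    show "c 0 = 0" using assms(2) d_pos[of 0] by simp
  next
    fix i assume "i < r"
    then have "real (c i) / real (d i) < real (c (Suc i)) / real (d (Suc i))"
      using assms(4) by blast
    then show "c i * d (Suc i) < c (Suc i) * d i"
      using d_pos[of i] d_pos[of "Suc i"] \<open>i < r\<close>
      by (simp add: divide_simps flip: of_nat_mult)
  next
    fix p q
    show "(\<exists>i\<le>r. p = c i \<and> q = d i) \<longleftrightarrow> q > 0 \<and> p * d r \<le> c r * q \<and>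
        (\<forall>p' q'. 0 < q' \<and> q' < q \<and> p * q' \<le> p' * q \<longrightarrow> c r * q' < p' * d r)"
    proof (cases "q = 0")
      case True
      \<comment> \<open>Both sides are false for denominator 0.\<close>
      then show ?thesis using mem[of p q] by (simp add: best_lower_approx_def)
    next
      case False
      then show ?thesis
        unfolding mem assms(3)[symmetric] using best_lower_approx_iff[of "d r" q] d_pos[of r] by simp
    qed
  qed
  have "of_nat k \<le> \<alpha> * of_nat n \<longleftrightarrow> (k, n) \<in> cone" for k n
  proof -
    \<comment> \<open>The comparison moves to the reals, where \<alpha> is known as
      \<open>c r / d r\<close>.\<close>
    have "of_nat k \<le> \<alpha> * of_nat n \<longleftrightarrow> (of_rat (of_nat k) :: real) \<le> of_rat (\<alpha> * of_nat n)"
      by (simp only: of_rat_less_eq)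
    also have "\<dots> \<longleftrightarrow> real k \<le> real (c r) / real (d r) * real n"
      unfolding assms(3) by (simp add: of_rat_mult)
    also have "\<dots> \<longleftrightarrow> (k, n) \<in> cone"
      using d_pos[of r] by (simp add: cone_def divide_simps flip: of_nat_mult)
    finally show ?thesis .
  qed
  then have "canonical_ring (Poly_Mapping.single (Infinity :: 'k p1_point) \<alpha>) = monomial_span cone"
    unfolding canonical_ring_eq_monomial_span[OF assms(1)] by simp
  then show ?thesis
    using minimal_presentation_cone card_pairs[of r] by simp
qed

end
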